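(* Let $N\geq1$ and $0\leq n\leq N-1$ be integers, let $q\in W^{N,\infty}(\mathbb R;\mathbb C)$, and let $\gamma_n:\mathbb R\to(0,\infty)$ be an even function for which there are constants $c_n,C_n>0$ with $$c_n(1+|t|)^{-n}\leq\gamma_n(t)\leq C_n(1+|t|)^{-n},\qquad t\in\mathbb R.$$ Put $$\Omega_{n,+}^{\rm D}=\{z\in\mathbb C:\ \operatorname{Im}z>\gamma_n(\operatorname{Re}z)\},\qquad \Omega_{n,-}^{\rm D}=\{z\in\mathbb C:\ -\operatorname{Im}z>\gamma_n(\operatorname{Re}z)\}.$$ Let $m_\pm$ be the Weyl functions of the self-adjoint Dirac operator $$D_q^{\rm sa}=i\begin{pmatrix}1&0\\0&-1\end{pmatrix}\frac{d}{dx}+\begin{pmatrix}0&q\\ \overline q&0\end{pmatrix}.$$ Then, as $|z|\to\infty$, $$m_+(z)=\sum_{j=1}^{N-n-1}c_j(0)z^{-j}+O(|z|^{n-N}),\qquad z\in\Omega_{n,-}^{\rm D},$$ $$m_-(z)=\sum_{j=1}^{N-n-1}c_j(0)z^{-j}+O(|z|^{n-N}),\qquad z\in\Omega_{n,+}^{\rm D},$$ with error terms uniform in the indicated regions. The coefficients (the same for $m_+$ and $m_-$) are determined by $$c_1=\frac{\overline q}{2},\qquad c_{j+1}=-\frac i2c_j'+\frac q2\sum_{\ell=1}^{j-1}c_\ell c_{j-\ell},\quad j\geq1.$$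
   Context: $W^{N,\infty}(\mathbb R;\mathbb C)$ is the space of complex-valued functions on $\mathbb R$ whose weak derivatives up to order $N$ are in $L^\infty$ (continuous representatives are used). $\mathbb C_\pm=\{z\in\mathbb C:\pm\operatorname{Im}z>0\}$. Weyl functions: let $\boldsymbol f_+(\cdot,z)$ and $\boldsymbol f_-(\cdot,z)$ denote nonzero $\mathbb C^2$-valued solutions of $D_q^{\rm sa}\boldsymbol f=z\boldsymbol f$ on $\mathbb R$ that are square integrable near $+\infty$ and near $-\infty$, respectively, with components $f_{\pm,1},f_{\pm,2}$. Define $$m_+(z)=\frac{f_{+,2}(0,z)}{f_{+,1}(0,z)}\ \text{ for } z\in\mathbb C_-,\qquad m_-(z)=\frac{f_{-,2}(0,z)}{f_{-,1}(0,z)}\ \text{ for } z\in\mathbb C_+.$$ The $O$-statements mean: there are constants $C,R>0$ such that for all $z$ in the indicated region with $|z|\ge R$ the remainder is bounded in modulus by $C|z|^{n-N}$. Empty sums are zero. *)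

theory Defs
  imports "HOL-Analysis.Analysis"
begin

definition iter_deriv :: "nat \<Rightarrow> (real \<Rightarrow> complex) \<Rightarrow> real \<Rightarrow> complex" where
  "iter_deriv k f = ((\<lambda>g x. vector_derivative g (at x)) ^^ k) f"

definition test_function :: "(real \<Rightarrow> complex) \<Rightarrow> bool" where
  "test_function \<phi> \<longleftrightarrow>
     (\<forall>k x. iter_deriv k \<phi> differentiable (at x)) \<and> compact (closure {x. \<phi> x \<noteq> 0})"

definition L_infty :: "(real \<Rightarrow> complex) \<Rightarrow> bool" where
  "L_infty g \<longleftrightarrow> g \<in> borel_measurable lborel \<and> (\<exists>B. AE x in lborel. cmod (g x) \<le> B)"

definition weak_deriv :: "nat \<Rightarrow> (real \<Rightarrow> complex) \<Rightarrow> (real \<Rightarrow> complex) \<Rightarrow> bool" where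
  "weak_deriv k f g \<longleftrightarrow>
     (\<forall>\<phi>. test_function \<phi> \<longrightarrow>
        (LINT x|lborel. f x * iter_deriv k \<phi> x) = (-1) ^ k * (LINT x|lborel. g x * \<phi> x))"

text \<open>Membership of a function (not of its almost-everywhere class); continuity of the
  representative is not included and has to be required separately.\<close>

definition W_infty :: "nat \<Rightarrow> (real \<Rightarrow> complex) \<Rightarrow> bool" where
  "W_infty N q \<longleftrightarrow> L_infty q \<and> (\<forall>k\<in>{1..N}. \<exists>g. L_infty g \<and> weak_deriv k q g)"

definition dirac :: "(real \<Rightarrow> complex) \<Rightarrow> (real \<Rightarrow> complex^2) \<Rightarrow> real \<Rightarrow> complex^2" where
  "dirac q f x =
     \<i> *s ((vector [vector [1, 0], vector [0, -1]] :: complex^2^2) *v vector_derivative f (at x))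
     + (vector [vector [0, q x], vector [cnj (q x), 0]] :: complex^2^2) *v f x"

text \<open>Solutions are classical. For continuous \<open>q\<close> every locally absolutely continuous
  almost-everywhere solution is of this kind.\<close>

definition dirac_solution :: "(real \<Rightarrow> complex) \<Rightarrow> complex \<Rightarrow> (real \<Rightarrow> complex^2) \<Rightarrow> bool" where
  "dirac_solution q z f \<longleftrightarrow> (\<forall>x. f differentiable (at x)) \<and> (\<forall>x. dirac q f x = z *s f x)"

definition weyl_solution_plus :: "(real \<Rightarrow> complex) \<Rightarrow> complex \<Rightarrow> (real \<Rightarrow> complex^2) \<Rightarrow> bool" where
  "weyl_solution_plus q z f \<longleftrightarrow>
     dirac_solution q z f \<and> (\<exists>x. f x \<noteq> 0) \<and>
     (\<exists>a. set_integrable lborel {a..} (\<lambda>x. (norm (f x))\<^sup>2))"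

definition weyl_solution_minus :: "(real \<Rightarrow> complex) \<Rightarrow> complex \<Rightarrow> (real \<Rightarrow> complex^2) \<Rightarrow> bool" where
  "weyl_solution_minus q z f \<longleftrightarrow>
     dirac_solution q z f \<and> (\<exists>x. f x \<noteq> 0) \<and>
     (\<exists>a. set_integrable lborel {..a} (\<lambda>x. (norm (f x))\<^sup>2))"

text \<open>The quotient of components at the origin. The denominator is nonzero for the solutions
  it is applied to, since
  \<open>(\<bar>f\<^sub>1\<bar>\<^sup>2 - \<bar>f\<^sub>2\<bar>\<^sup>2)' = 2 (Im z) (\<bar>f\<^sub>1\<bar>\<^sup>2 + \<bar>f\<^sub>2\<bar>\<^sup>2)\<close>.\<close>

definition weyl_m :: "(complex \<Rightarrow> real \<Rightarrow> complex^2) \<Rightarrow> complex \<Rightarrow> complex" where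
  "weyl_m f z = f z 0 $ 2 / f z 0 $ 1"

definition Omega_plus :: "(real \<Rightarrow> real) \<Rightarrow> complex set" where
  "Omega_plus \<gamma> = {z. Im z > \<gamma> (Re z)}"

definition Omega_minus :: "(real \<Rightarrow> real) \<Rightarrow> complex set" where
  "Omega_minus \<gamma> = {z. - Im z > \<gamma> (Re z)}"

text \<open>The coefficients are indexed from 1; the value at index 0 is a dummy and is never used.\<close>

fun dirac_coeff :: "(real \<Rightarrow> complex) \<Rightarrow> nat \<Rightarrow> real \<Rightarrow> complex" where
  "dirac_coeff q 0 = (\<lambda>x. 0)"
| "dirac_coeff q (Suc 0) = (\<lambda>x. cnj (q x) / 2)"
| "dirac_coeff q (Suc (Suc j)) = (\<lambda>x.
     - (\<i> / 2) * vector_derivative (dirac_coeff q (Suc j)) (at x)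
     + q x / 2 * (\<Sum>l = 1..j. dirac_coeff q l x * dirac_coeff q (Suc j - l) x))"

end

theory Submission
  imports Defs
begin

text \<open>
For a solution \<open>f\<close> of the Dirac equation the quotient \<open>m = f\<^sub>2 / f\<^sub>1\<close> satisfies the Riccati equation
\<open>m' = 2 \<i> z m - \<i> (cnj q + q m\<^sup>2)\<close>, and the recursion for the coefficients \<open>c\<^sub>j\<close> says precisely that
\<open>\<Sum> c\<^sub>j z\<^sup>-\<^sup>j\<close> solves this equation formally. A \<open>q\<close> in the Sobolev class of order \<open>N\<close> is \<open>N - 1\<close> times
differentiable with bounded derivatives, the last one Lipschitz (\<open>W_infty_bounded_lipschitz_deriv\<close>), so
\<open>c\<^sub>1, \<dots>, c\<^sub>N\<close> exist and \<open>c\<^sub>N\<close> is Lipschitz. The sum of the first \<open>N\<close> terms, with \<open>c\<^sub>N\<close> averaged over an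
interval of length \<open>1 / \<bar>z\<bar>\<close> to make it differentiable, is then a function \<open>p\<close> that satisfies the
Riccati equation up to a residual \<open>\<rho> = O(\<bar>z\<bar>\<^sup>-\<^sup>N)\<close>, uniformly on the line
(\<open>riccati_approximate_solution\<close>).

The point is to deduce \<open>\<bar>m - p\<bar> = O(\<bar>\<rho>\<bar> / \<bar>Im z\<bar>)\<close> when \<open>Im z\<close> may be far smaller than \<open>q\<close>, so
that \<open>q\<close> cannot be treated as a perturbation. For \<open>Im z < 0\<close> square integrability at \<open>+\<infinity>\<close> forces
\<open>\<bar>m\<bar> < 1\<close> on the whole line (\<open>weyl_solution_plus_disc\<close>), and the Riccati flow expands the hyperbolic
metric of the unit disc. With \<open>Q = \<bar>m - p\<bar>\<^sup>2 / ((1 - \<bar>m\<bar>\<^sup>2) (1 - \<bar>p\<bar>\<^sup>2))\<close>, a function of the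
hyperbolic distance of \<open>m\<close> and \<open>p\<close>, all terms that contain \<open>q\<close> cancel in \<open>Q'\<close>, which leaves
\<open>Q' \<ge> 2 \<eta> Q - O(sup \<bar>\<rho>\<bar>\<^sup>2 / \<eta>)\<close> for \<open>\<eta> = - Im z\<close>. As \<open>Q\<close> is bounded on the line for each fixed \<open>z\<close>,
it cannot grow exponentially, so \<open>Q = O(sup \<bar>\<rho>\<bar>\<^sup>2 / \<eta>\<^sup>2)\<close> (\<open>riccati_comparison\<close>).

In the regions considered \<open>\<bar>Im z\<bar>\<close> is at least a constant times \<open>\<bar>z\<bar>\<^sup>-\<^sup>n\<close>, so the error is
\<open>O(\<bar>z\<bar>\<^sup>n\<^sup>-\<^sup>N)\<close>; the terms of \<open>p\<close> with index at least \<open>N - n\<close> have at most this size and are dropped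
(\<open>expansion_from_comparison\<close>). The upper half plane reduces to the lower one by the reflection
\<open>x \<mapsto> - x\<close>, \<open>z \<mapsto> - z\<close>, \<open>q \<mapsto> - q(- \<cdot>)\<close>, which leaves the components of the solution unchanged.
\<close>

section \<open>Smooth functions with compact support\<close>

text \<open>
The functions \<open>x\<^sup>-\<^sup>k exp (- 1 / x)\<close>, extended by zero; their linear combinations are closed
under differentiation.
\<close>

definition flat :: "nat \<Rightarrow> real \<Rightarrow> real" where
  "flat k x = (if x > 0 then (1 / x) ^ k * exp (- (1 / x)) else 0)"

lemma flat_div_tendsto_0: "((\<lambda>h. flat k h / h) \<longlongrightarrow> 0) (at 0)"
proof -
  have right: "((\<lambda>h. flat k h / h) \<longlongrightarrow> 0) (at_right 0)"
  proof -
    have "((\<lambda>t::real. t ^ Suc k / exp t) \<longlongrightarrow> 0) at_top"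
      by (rule tendsto_power_div_exp_0)
    then have "((\<lambda>h::real. inverse h ^ Suc k / exp (inverse h)) \<longlongrightarrow> 0) (at_right 0)"
      by (rule filterlim_compose[OF _ filterlim_inverse_at_top_right])
    then show ?thesis
    proof (rule Lim_transform_eventually)
      show "\<forall>\<^sub>F h in at_right 0. inverse h ^ Suc k / exp (inverse h) = flat k h / h"
        using eventually_at_right_less[of "0::real"]
        by eventually_elim (simp add: flat_def exp_minus field_simps)
    qed
  qed
  have left: "((\<lambda>h. flat k h / h) \<longlongrightarrow> 0) (at_left 0)"
    by (rule tendsto_eventually) (auto simp: eventually_at_filter flat_def)
  show ?thesis
    using left right by (simp add: filterlim_at_split)
qed

lemma flat_has_derivative:
  "(flat k has_real_derivative flat (k + 2) x - real k * flat (k + 1) x) (at x)"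
proof -
  consider "x > 0" | "x < 0" | "x = 0" by linarith
  then show ?thesis
  proof cases
    case 1
    have ev: "\<forall>\<^sub>F y in nhds x. (1 / y) ^ k * exp (- (1 / y)) = flat k y"
      using eventually_nhds_in_open[of "{0<..}" x] 1
      by (auto elim!: eventually_mono simp: flat_def)
    have d: "((\<lambda>x. 1 / x) has_real_derivative - ((1 / x)\<^sup>2)) (at x)"
      using 1 by (auto intro!: derivative_eq_intros simp: power2_eq_square)
    have "((\<lambda>x. (1 / x) ^ k * exp (- (1 / x))) has_real_derivative
            flat (k + 2) x - real k * flat (k + 1) x) (at x)"
      by (rule DERIV_cong[OF DERIV_mult[OF DERIV_power[OF d, of k] DERIV_exp[THEN DERIV_chain2, OF DERIV_minus[OF d]]]])
         (use 1 in \<open>cases k; simp add: flat_def algebra_simps power2_eq_square\<close>)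
    from ev this show ?thesis
      by (rule DERIV_cong_ev[OF refl _ refl, THEN iffD1])
  next
    case 2
    have "\<forall>\<^sub>F y in nhds x. 0 = flat k y"
      using eventually_nhds_in_open[of "{..<0}" x] 2
      by (auto elim!: eventually_mono simp: flat_def)
    moreover have "((\<lambda>_. 0) has_real_derivative flat (k + 2) x - real k * flat (k + 1) x) (at x)"
      using 2 by (simp add: flat_def)
    ultimately show ?thesis
      by (rule DERIV_cong_ev[OF refl _ refl, THEN iffD1])
  next
    case 3
    then show ?thesis
      using flat_div_tendsto_0[of k] by (simp add: DERIV_def flat_def)
  qed
qed

text \<open>
An algebra that contains the bump functions and is closed under differentiation; all its members are
therefore smooth, without any computation of higher derivatives.
\<close>

inductive bump_algebra :: "(real \<Rightarrow> complex) \<Rightarrow> bool" where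
  flat: "bump_algebra (\<lambda>x. of_real (flat k (\<alpha> * x + \<beta>)))"
| const: "bump_algebra (\<lambda>x. c)"
| add: "bump_algebra f \<Longrightarrow> bump_algebra g \<Longrightarrow> bump_algebra (\<lambda>x. f x + g x)"
| mult: "bump_algebra f \<Longrightarrow> bump_algebra g \<Longrightarrow> bump_algebra (\<lambda>x. f x * g x)"

lemma bump_algebra_derivative:
  assumes "bump_algebra f"
  shows "\<exists>f'. bump_algebra f' \<and> (\<forall>x. (f has_vector_derivative f' x) (at x))"
  using assms
proof induction
  case (flat k \<alpha> \<beta>)
  define f' where "f' = (\<lambda>x. complex_of_real \<alpha> * (of_real (flat (k + 2) (\<alpha> * x + \<beta>))
      + (- of_real (real k)) * of_real (flat (k + 1) (\<alpha> * x + \<beta>))))"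
  have "bump_algebra f'"
    unfolding f'_def by (intro bump_algebra.intros)
  moreover have "((\<lambda>x. complex_of_real (flat k (\<alpha> * x + \<beta>))) has_vector_derivative f' x) (at x)" for x
  proof -
    have "((\<lambda>x. flat k (\<alpha> * x + \<beta>)) has_real_derivative
        (flat (k + 2) (\<alpha> * x + \<beta>) - real k * flat (k + 1) (\<alpha> * x + \<beta>)) * \<alpha>) (at x)"
      by (rule DERIV_chain2[OF flat_has_derivative]) (auto intro!: derivative_eq_intros)
    then have "((\<lambda>x. complex_of_real (flat k (\<alpha> * x + \<beta>))) has_vector_derivative
        of_real ((flat (k + 2) (\<alpha> * x + \<beta>) - real k * flat (k + 1) (\<alpha> * x + \<beta>)) * \<alpha>)) (at x)"
      by (rule has_vector_derivative_of_real)
    then show ?thesis by (simp add: f'_def algebra_simps)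
  qed
  ultimately show ?case by blast
next
  case (const c)
  show ?case by (rule exI[of _ "\<lambda>x. 0"]) (auto intro: bump_algebra.const)
next
  case (add f g)
  then obtain f' g' where "bump_algebra f'" "bump_algebra g'"
    "\<And>x. (f has_vector_derivative f' x) (at x)" "\<And>x. (g has_vector_derivative g' x) (at x)"
    by blast
  then show ?case
    by (intro exI[of _ "\<lambda>x. f' x + g' x"]) (auto intro: bump_algebra.add has_vector_derivative_add)
next
  case (mult f g)
  then obtain f' g' where "bump_algebra f'" "bump_algebra g'"
    "\<And>x. (f has_vector_derivative f' x) (at x)" "\<And>x. (g has_vector_derivative g' x) (at x)"
    by blast
  with mult.hyps show ?case
    by (intro exI[of _ "\<lambda>x. f x * g' x + f' x * g x"])
       (auto intro: bump_algebra.intros has_vector_derivative_mult)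
qed

lemma iter_deriv_0 [simp]: "iter_deriv 0 f = f"
  by (simp add: iter_deriv_def)

lemma iter_deriv_Suc: "iter_deriv (Suc k) f = iter_deriv k (\<lambda>x. vector_derivative f (at x))"
  by (simp add: iter_deriv_def funpow_Suc_right del: funpow.simps)

lemma iter_deriv_Suc':
  "iter_deriv (Suc k) f = (\<lambda>x. vector_derivative (iter_deriv k f) (at x))"
  by (simp add: iter_deriv_def)

lemma bump_algebra_iter_deriv:
  assumes "bump_algebra f"
  shows "bump_algebra (iter_deriv k f)"
  using assms
proof (induction k arbitrary: f)
  case (Suc k)
  obtain f' where f': "bump_algebra f'" "\<And>x. (f has_vector_derivative f' x) (at x)"
    using bump_algebra_derivative[OF Suc.prems] by blast
  then have "(\<lambda>x. vector_derivative f (at x)) = f'"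
    by (auto simp: vector_derivative_at)
  then show ?case using Suc.IH f'(1) by (simp add: iter_deriv_Suc)
qed simp

lemma bump_algebra_differentiable:
  assumes "bump_algebra f"
  shows "iter_deriv k f differentiable (at x)"
  using bump_algebra_derivative[OF bump_algebra_iter_deriv[OF assms]] differentiableI_vector by blast

definition bump :: "real \<Rightarrow> real \<Rightarrow> real \<Rightarrow> real" where
  "bump a b x = flat 0 (x - a) * flat 0 (b - x)"

lemma compact_closure_support_iff:
  "compact (closure {x::real. \<phi> x \<noteq> (0::complex)}) \<longleftrightarrow> (\<exists>A>0. \<forall>x. A < \<bar>x\<bar> \<longrightarrow> \<phi> x = 0)"
proof -
  have "compact (closure {x::real. \<phi> x \<noteq> (0::complex)}) \<longleftrightarrow> bounded {x. \<phi> x \<noteq> 0}"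
    by simp
  also have "\<dots> \<longleftrightarrow> (\<exists>A>0. \<forall>x. A < \<bar>x\<bar> \<longrightarrow> \<phi> x = 0)"
    unfolding bounded_pos by (auto simp: not_less[symmetric])
  finally show ?thesis .
qed

lemma test_function_bump: "test_function (\<lambda>x. of_real (bump a b x))"
proof -
  have "bump_algebra (\<lambda>x. of_real (flat 0 (1 * x + (- a))) * of_real (flat 0 ((- 1) * x + b)))"
    by (intro bump_algebra.intros)
  then have "bump_algebra (\<lambda>x. of_real (bump a b x))"
    by (simp add: bump_def)
  moreover have "\<exists>A>0. \<forall>x. A < \<bar>x\<bar> \<longrightarrow> complex_of_real (bump a b x) = 0"
    by (intro exI[of _ "\<bar>a\<bar> + \<bar>b\<bar> + 1"]) (auto simp: bump_def flat_def)
  ultimately show ?thesis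
    unfolding test_function_def compact_closure_support_iff
    using bump_algebra_differentiable by blast
qed

lemma bump_pos: "a < x \<Longrightarrow> x < b \<Longrightarrow> bump a b x > 0"
  and bump_nonneg: "bump a b x \<ge> 0"
  and bump_eq_0: "x \<le> a \<or> b \<le> x \<Longrightarrow> bump a b x = 0"
  by (auto simp: bump_def flat_def)

section \<open>From weak to classical derivatives\<close>

lemma test_function_has_derivative:
  assumes "test_function \<phi>"
  shows "(iter_deriv k \<phi> has_vector_derivative iter_deriv (Suc k) \<phi> x) (at x)"
  using assms by (simp add: test_function_def iter_deriv_Suc' vector_derivative_works)

lemma test_function_continuous:
  assumes "test_function \<phi>"
  shows "continuous_on S (iter_deriv k \<phi>)"
  by (meson assms continuous_at_imp_continuous_on has_vector_derivative_continuous
      test_function_has_derivative)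

lemma test_function_support:
  assumes "test_function \<phi>"
  obtains A where "A > 0" "\<And>k x. A \<le> \<bar>x\<bar> \<Longrightarrow> iter_deriv k \<phi> x = 0"
proof -
  obtain A where A: "A > 0" "\<And>x. A < \<bar>x\<bar> \<Longrightarrow> \<phi> x = 0"
    using assms unfolding test_function_def compact_closure_support_iff by blast
  have zero: "A < \<bar>x\<bar> \<Longrightarrow> iter_deriv k \<phi> x = 0" for k x
  proof (induction k arbitrary: x)
    case (Suc k)
    have "open {x::real. A < \<bar>x\<bar>}"
      by (intro open_Collect_less continuous_intros)
    then have "((\<lambda>_. 0) has_vector_derivative iter_deriv (Suc k) \<phi> x) (at x)"
      by (rule has_vector_derivative_transform_within_open[OF test_function_has_derivative[OF assms]])
         (use Suc in auto)
    then show ?case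
      using vector_derivative_unique_at[OF _ has_vector_derivative_const] by blast
  qed (use A in auto)
  show thesis
    by (rule that[of "A + 1"]) (use A zero in auto)
qed

lemma test_function_combination:
  assumes "test_function \<phi>" and "test_function \<psi>"
  shows "iter_deriv k (\<lambda>x. \<phi> x - c * \<psi> x) = (\<lambda>x. iter_deriv k \<phi> x - c * iter_deriv k \<psi> x)"
    and "test_function (\<lambda>x. \<phi> x - c * \<psi> x)"
proof -
  have deriv: "((\<lambda>x. iter_deriv k \<phi> x - c * iter_deriv k \<psi> x) has_vector_derivative
      iter_deriv (Suc k) \<phi> x - c * iter_deriv (Suc k) \<psi> x) (at x)" for k x
    using assms by (intro has_vector_derivative_diff has_vector_derivative_mult_right
        test_function_has_derivative)
  have iter: "iter_deriv k (\<lambda>x. \<phi> x - c * \<psi> x) = (\<lambda>x. iter_deriv k \<phi> x - c * iter_deriv k \<psi> x)" for k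
  proof (induction k)
    case (Suc k)
    then show ?case
      using vector_derivative_at[OF deriv] by (simp add: iter_deriv_Suc'[of k "\<lambda>x. \<phi> x - c * \<psi> x"])
  qed simp
  show "iter_deriv k (\<lambda>x. \<phi> x - c * \<psi> x) = (\<lambda>x. iter_deriv k \<phi> x - c * iter_deriv k \<psi> x)"
    by (rule iter)
  obtain A B where "A > 0" "\<And>k x. A \<le> \<bar>x\<bar> \<Longrightarrow> iter_deriv k \<phi> x = 0"
      and "B > 0" "\<And>k x. B \<le> \<bar>x\<bar> \<Longrightarrow> iter_deriv k \<psi> x = 0"
    using test_function_support assms by metis
  from this(2,4)[of _ 0] this(1,3) have "\<exists>A>0. \<forall>x. A < \<bar>x\<bar> \<longrightarrow> \<phi> x - c * \<psi> x = 0"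
    by (intro exI[of _ "A + B"]) auto
  then show "test_function (\<lambda>x. \<phi> x - c * \<psi> x)"
    unfolding test_function_def compact_closure_support_iff iter
    using deriv differentiableI_vector by blast
qed

lemma integrable_continuous_compact_support:
  fixes h :: "real \<Rightarrow> complex"
  assumes "continuous_on UNIV h" and "\<And>x. A \<le> \<bar>x\<bar> \<Longrightarrow> h x = 0"
  shows "integrable lborel h"
proof -
  have "integrable lborel (\<lambda>x. indicator {-A..A} x *\<^sub>R h x)"
    using assms by (intro borel_integrable_compact) (auto intro: continuous_on_subset)
  also have "(\<lambda>x. indicator {-A..A} x *\<^sub>R h x) = h"
  proof
    fix x show "indicator {-A..A} x *\<^sub>R h x = h x"
      using assms(2)[of x] by (cases "A \<le> \<bar>x\<bar>") (auto simp: indicator_def)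
  qed
  finally show ?thesis .
qed

lemma integrable_times_test_function:
  assumes "continuous_on UNIV v" and "test_function \<phi>"
  shows "integrable lborel (\<lambda>x. v x * iter_deriv k \<phi> x)"
proof -
  obtain A where "A > 0" "\<And>k x. A \<le> \<bar>x\<bar> \<Longrightarrow> iter_deriv k \<phi> x = 0"
    using test_function_support[OF assms(2)] by blast
  then show ?thesis
    by (intro integrable_continuous_compact_support[of _ A] continuous_intros assms
        test_function_continuous) auto
qed

lemma antiderivative_exists:
  fixes f :: "real \<Rightarrow> complex"
  assumes "continuous_on UNIV f"
  obtains F where "\<And>x. (F has_vector_derivative f x) (at x)"
proof
  fix x :: real
  define b where "b = \<bar>x\<bar> + 1"
  have "((\<lambda>u. LBINT y=ereal 0..u. f y) has_vector_derivative f x) (at x within {-b..b})"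
    by (rule interval_integral_FTC2) (auto simp: b_def intro: continuous_on_subset[OF assms])
  moreover have "at x within {-b..b} = at x"
    by (rule at_within_interior) (auto simp: b_def)
  ultimately show "((\<lambda>u. LBINT y=ereal 0..u. f y) has_vector_derivative f x) (at x)"
    by simp
qed

lemma integral_derivative_Icc:
  fixes F f :: "real \<Rightarrow> complex"
  assumes "\<And>x. (F has_vector_derivative f x) (at x)" and "continuous_on UNIV f" and "a \<le> b"
  shows "(LINT x:{a..b}|lborel. f x) = F b - F a"
  unfolding set_lebesgue_integral_def
  by (rule integral_FTC_atLeastAtMost)
     (use assms in \<open>auto intro: has_vector_derivative_at_within continuous_on_subset\<close>)

lemma test_function_antiderivative:
  assumes \<psi>: "test_function \<psi>" and mean: "(LINT x|lborel. \<psi> x) = 0"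
  obtains \<phi> where "test_function \<phi>" "\<And>x. (\<phi> has_vector_derivative \<psi> x) (at x)"
    "\<And>k. iter_deriv (Suc k) \<phi> = iter_deriv k \<psi>"
proof -
  obtain A where A: "A > 0" "\<And>k x. A \<le> \<bar>x\<bar> \<Longrightarrow> iter_deriv k \<psi> x = 0"
    using test_function_support[OF \<psi>] by blast
  have cont: "continuous_on UNIV \<psi>"
    using test_function_continuous[OF \<psi>, of _ 0] by simp
  obtain F where F: "\<And>x. (F has_vector_derivative \<psi> x) (at x)"
    using antiderivative_exists[OF cont] by blast
  define \<phi> where "\<phi> x = F x - F (- A)" for x
  have deriv: "(\<phi> has_vector_derivative \<psi> x) (at x)" for x
    unfolding \<phi>_def using has_vector_derivative_diff[OF F has_vector_derivative_const] by simp
  have flat_part: "F b = F a" if "a \<le> b" "\<And>x. x \<in> {a..b} \<Longrightarrow> \<psi> x = 0" for a b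
  proof -
    have "(LINT x:{a..b}|lborel. \<psi> x) = (LINT x:{a..b}|lborel. 0)"
      by (rule set_lebesgue_integral_cong) (use that in auto)
    then show ?thesis
      using integral_derivative_Icc[OF F cont \<open>a \<le> b\<close>] by simp
  qed
  have middle: "F A = F (- A)"
  proof -
    have "(LINT x:{-A..A}|lborel. \<psi> x) = (LINT x|lborel. \<psi> x)"
      unfolding set_lebesgue_integral_def
    proof (rule Bochner_Integration.integral_cong[OF refl])
      fix x show "indicator {-A..A} x *\<^sub>R \<psi> x = \<psi> x"
        using A(2)[of x 0] by (cases "A \<le> \<bar>x\<bar>") (auto simp: indicator_def)
    qed
    then show ?thesis
      using integral_derivative_Icc[OF F cont, of "-A" A] A(1) mean by simp
  qed
  have supp: "\<phi> x = 0" if "A < \<bar>x\<bar>" for x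
  proof (cases "x < 0")
    case True
    then have "F (- A) = F x"
      by (intro flat_part) (use that A(2)[of _ 0] in auto)
    then show ?thesis by (simp add: \<phi>_def)
  next
    case False
    then have "F x = F A"
      by (intro flat_part) (use that A(2)[of _ 0] in auto)
    then show ?thesis by (simp add: \<phi>_def middle)
  qed
  have iter: "iter_deriv (Suc k) \<phi> = iter_deriv k \<psi>" for k
    using vector_derivative_at[OF deriv] by (simp add: iter_deriv_Suc)
  have "iter_deriv k \<phi> differentiable (at x)" for k x
    by (cases k) (use deriv differentiableI_vector \<psi>[unfolded test_function_def] in \<open>auto simp: iter\<close>)
  then have "test_function \<phi>"
    unfolding test_function_def compact_closure_support_iff using A(1) supp by blast
  then show thesis using deriv iter by (rule that)
qed

text \<open>
Integration by parts with a merely locally integrable \<open>g\<close> in place of a derivative of \<open>G\<close>: both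
sides are iterated integrals of \<open>g x * \<psi> s\<close> over the triangle \<open>x \<le> s\<close>.
\<close>

lemma integral_by_parts_compact_support:
  fixes g G \<phi> \<psi> :: "real \<Rightarrow> complex"
  assumes g: "\<And>a b. set_integrable lborel {a..b} g"
    and G: "\<And>x y. x \<le> y \<Longrightarrow> G y - G x = (LINT t:{x..y}|lborel. g t)"
    and contG: "continuous_on UNIV G"
    and \<phi>: "\<And>x. (\<phi> has_vector_derivative \<psi> x) (at x)"
    and cont: "continuous_on UNIV \<psi>"
    and A: "A > 0" and \<phi>0: "\<And>x. A \<le> \<bar>x\<bar> \<Longrightarrow> \<phi> x = 0" and \<psi>0: "\<And>x. A \<le> \<bar>x\<bar> \<Longrightarrow> \<psi> x = 0"
  shows "(LINT x|lborel. g x * \<phi> x) = - (LINT x|lborel. G x * \<psi> x)"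
proof -
  define g1 where "g1 x = indicator {-A..A} x *\<^sub>R g x" for x
  have g1: "integrable lborel g1"
    using g[of "-A" A] unfolding set_integrable_def g1_def .
  have \<psi>: "integrable lborel \<psi>"
    by (rule integrable_continuous_compact_support[OF cont \<psi>0])
  note [measurable] = borel_measurable_integrable[OF g1] borel_measurable_integrable[OF \<psi>]
  have prod: "integrable (lborel \<Otimes>\<^sub>M lborel) (\<lambda>p. g1 (fst p) * \<psi> (snd p))"
  proof (rule lborel_pair.Fubini_integrable)
    show "integrable lborel (\<lambda>x. LINT y|lborel. norm (g1 (fst (x, y)) * \<psi> (snd (x, y))))"
      using g1 by (simp add: norm_mult)
    show "AE x in lborel. integrable lborel (\<lambda>y. g1 (fst (x, y)) * \<psi> (snd (x, y)))"
      using \<psi> by simp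
  qed measurable
  \<comment> \<open>The integrand over the triangle; \<open>g\<close> is cut off to make it integrable over the plane.\<close>
  define K where "K x s = (if x \<le> s then g1 x * \<psi> s else 0)" for x s
  have K: "integrable (lborel \<Otimes>\<^sub>M lborel) (case_prod K)"
  proof (rule Bochner_Integration.integrable_bound[OF prod])
    show "case_prod K \<in> borel_measurable (lborel \<Otimes>\<^sub>M lborel)"
      unfolding K_def by measurable
  qed (auto simp: K_def)
  have inner_s: "(LINT s|lborel. K x s) = - (g x * \<phi> x)" for x
  proof (cases "x \<in> {-A..A}")
    case False
    then have "K x s = 0" for s
      by (simp add: K_def g1_def)
    moreover have "A \<le> \<bar>x\<bar>" using False by auto
    ultimately show ?thesis using \<phi>0[of x] by simp
  next
    case True
    have "K x s = g1 x * (indicator {x..A} s *\<^sub>R \<psi> s)" for s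
      using True \<psi>0[of s] by (auto simp: K_def indicator_def)
    then have "(LINT s|lborel. K x s) = g1 x * (LINT s:{x..A}|lborel. \<psi> s)"
      by (simp only: set_lebesgue_integral_def integral_mult_right_zero)
    also have "\<dots> = g1 x * (\<phi> A - \<phi> x)"
      using True by (subst integral_derivative_Icc[OF \<phi> cont]) auto
    finally show ?thesis
      using True \<phi>0[of A] A by (simp add: g1_def)
  qed
  have inner_x: "(LINT x|lborel. K x s) = (G s - G (- A)) * \<psi> s" for s
  proof (cases "A \<le> \<bar>s\<bar>")
    case True
    then have "K x s = 0" for x using \<psi>0[OF True] by (simp add: K_def)
    then show ?thesis using \<psi>0[OF True] by simp
  next
    case False
    have "K x s = (indicator {-A..s} x *\<^sub>R g x) * \<psi> s" for x
      using False by (auto simp: K_def g1_def indicator_def)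
    then have "(LINT x|lborel. K x s) = (LINT x:{-A..s}|lborel. g x) * \<psi> s"
      by (simp only: set_lebesgue_integral_def integral_mult_left_zero)
    then show ?thesis using False by (subst G) auto
  qed
  have "(LINT x|lborel. \<psi> x) = (LINT x:{-A..A}|lborel. \<psi> x)"
    unfolding set_lebesgue_integral_def
    by (rule Bochner_Integration.integral_cong[OF refl]) (use \<psi>0 in \<open>auto simp: indicator_def\<close>)
  also have "\<dots> = 0"
    using A \<phi>0[of A] \<phi>0[of "-A"] by (subst integral_derivative_Icc[OF \<phi> cont]) auto
  finally have mean: "(LINT x|lborel. \<psi> x) = 0" .
  have G\<psi>: "integrable lborel (\<lambda>x. G x * \<psi> x)"
    by (rule integrable_continuous_compact_support[of _ A])
       (use contG cont \<psi>0 in \<open>auto intro!: continuous_intros\<close>)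
  have "(LINT x|lborel. g x * \<phi> x) = - (LINT x|lborel. LINT s|lborel. K x s)"
    by (simp add: inner_s)
  also have "\<dots> = - (LINT s|lborel. LINT x|lborel. K x s)"
    by (simp add: lborel_pair.Fubini_integral[OF K])
  also have "\<dots> = - (LINT s|lborel. G s * \<psi> s - G (- A) * \<psi> s)"
    by (simp add: inner_x algebra_simps)
  also have "\<dots> = - (LINT x|lborel. G x * \<psi> x)"
    using G\<psi> \<psi> mean by simp
  finally show ?thesis .
qed

text \<open>
The du Bois-Reymond argument. If \<open>\<psi>\<^sub>1\<close> is a fixed test function of nonzero mean, then every test function
differs by a multiple of \<open>\<psi>\<^sub>1\<close> from the derivative of a test function; testing with that antiderivative
trades one derivative of the test function for a primitive of \<open>g\<close>, and the multiple accounts for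
the constant of integration.
\<close>

lemma weak_deriv_lower:
  assumes wd: "weak_deriv (Suc k) u g" and u: "continuous_on UNIV u"
    and g: "\<And>a b. set_integrable lborel {a..b} g"
    and G: "\<And>x y. x \<le> y \<Longrightarrow> G y - G x = (LINT t:{x..y}|lborel. g t)"
    and contG: "continuous_on UNIV G"
  obtains c where "weak_deriv k u (\<lambda>x. G x + c)"
proof -
  define \<psi>1 where "\<psi>1 x = complex_of_real (bump 0 1 x)" for x
  define I where "I = (LINT x|lborel. bump 0 1 x)"
  have \<psi>1: "test_function \<psi>1"
    unfolding \<psi>1_def by (rule test_function_bump)
  have int1: "integrable lborel (\<lambda>x. bump 0 1 x)"
  proof -
    have "integrable lborel \<psi>1"
      using integrable_times_test_function[OF continuous_on_const[of _ 1] \<psi>1, of 0] by simp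
    then have "integrable lborel (\<lambda>x. Re (\<psi>1 x))"
      by (rule integrable_Re)
    then show ?thesis
      unfolding \<psi>1_def Re_complex_of_real .
  qed
  have "I \<noteq> 0"
  proof
    assume "I = 0"
    then have "AE x in lborel. bump 0 1 x = 0"
      using integral_nonneg_eq_0_iff_AE[OF int1] bump_nonneg by (simp add: I_def)
    then have "AE x in lborel. x \<notin> {0<..<1::real}"
      by eventually_elim (use bump_pos in force)
    then have "emeasure lborel {x::real. \<not> x \<notin> {0<..<1}} = 0"
      by (subst (asm) AE_iff_measurable[OF _ refl]) auto
    also have "{x::real. \<not> x \<notin> {0<..<1}} = {0<..<1}" by auto
    finally show False by simp
  qed
  have mean1: "(LINT x|lborel. \<psi>1 x) = of_real I"
    unfolding \<psi>1_def I_def by (rule integral_of_real[OF int1])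
  define a where "a = (LINT x|lborel. u x * iter_deriv k \<psi>1 x)"
  define b where "b = (LINT x|lborel. G x * \<psi>1 x)"
  define c where "c = ((-1) ^ k * a - b) / of_real I"
  have "weak_deriv k u (\<lambda>x. G x + c)"
    unfolding weak_deriv_def
  proof (intro allI impI)
    fix \<psi> assume \<psi>: "test_function \<psi>"
    define m where "m = (LINT x|lborel. \<psi> x)"
    define r where "r = m / of_real I"
    have m: "m = r * of_real I"
      using \<open>I \<noteq> 0\<close> by (simp add: r_def)
    \<comment> \<open>Subtracting this multiple of \<open>\<psi>1\<close> makes the mean vanish, so that \<open>\<xi>\<close> has an antiderivative with compact support.\<close>
    define \<xi> where "\<xi> = (\<lambda>x. \<psi> x - r * \<psi>1 x)"
    have \<xi>: "test_function \<xi>" and \<xi>_iter: "iter_deriv j \<xi> x = iter_deriv j \<psi> x - r * iter_deriv j \<psi>1 x" for j x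
      using test_function_combination[OF \<psi> \<psi>1] by (simp_all add: \<xi>_def)
    have int: "integrable lborel \<psi>" "integrable lborel \<psi>1"
      using integrable_times_test_function[OF continuous_on_const[of _ 1] \<psi>, of 0]
        integrable_times_test_function[OF continuous_on_const[of _ 1] \<psi>1, of 0] by simp_all
    have "(LINT x|lborel. \<xi> x) = 0"
      using int mean1 m by (simp add: \<xi>_def m_def)
    then obtain \<phi> where \<phi>: "test_function \<phi>" "\<And>x. (\<phi> has_vector_derivative \<xi> x) (at x)"
      "\<And>k. iter_deriv (Suc k) \<phi> = iter_deriv k \<xi>"
      using test_function_antiderivative[OF \<xi>] by blast
    obtain A where A: "A > 0" "\<And>k x. A \<le> \<bar>x\<bar> \<Longrightarrow> iter_deriv k \<phi> x = 0"
      using test_function_support[OF \<phi>(1)] by blast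
    have parts: "(LINT x|lborel. g x * \<phi> x) = - (LINT x|lborel. G x * \<xi> x)"
      by (rule integral_by_parts_compact_support[OF g G contG \<phi>(2) _ A(1)])
         (use A(2)[of _ 0] A(2)[of _ "Suc 0"] \<phi>(3)[of 0] test_function_continuous[OF \<xi>, of _ 0] in auto)
    have G\<xi>: "(LINT x|lborel. G x * \<xi> x) = (LINT x|lborel. G x * \<psi> x) - r * b"
      using integrable_times_test_function[OF contG \<psi>, of 0]
        integrable_times_test_function[OF contG \<psi>1, of 0]
      by (simp add: \<xi>_def b_def right_diff_distrib mult.left_commute[of _ r])
    have u\<xi>: "(LINT x|lborel. u x * iter_deriv k \<xi> x)
        = (LINT x|lborel. u x * iter_deriv k \<psi> x) - r * a"
      using integrable_times_test_function[OF u \<psi>, of k]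
        integrable_times_test_function[OF u \<psi>1, of k]
      by (simp add: \<xi>_iter a_def right_diff_distrib mult.left_commute[of _ r])
    have Gc: "(LINT x|lborel. (G x + c) * \<psi> x) = (LINT x|lborel. G x * \<psi> x) + c * m"
      using integrable_times_test_function[OF contG \<psi>, of 0] int
      by (simp add: distrib_right m_def)
    have "(LINT x|lborel. u x * iter_deriv (Suc k) \<phi> x) = (-1) ^ Suc k * (LINT x|lborel. g x * \<phi> x)"
      using wd \<phi>(1) unfolding weak_deriv_def by blast
    then have "(LINT x|lborel. u x * iter_deriv k \<xi> x) = (-1) ^ k * (LINT x|lborel. G x * \<xi> x)"
      by (simp add: \<phi>(3) parts)
    then have "(LINT x|lborel. u x * iter_deriv k \<psi> x)
        = (-1) ^ k * ((LINT x|lborel. G x * \<psi> x) - r * b) + r * a"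
      by (simp add: u\<xi> G\<xi> algebra_simps)
    also have "\<dots> = (-1) ^ k * ((LINT x|lborel. G x * \<psi> x) + c * m)"
      using \<open>I \<noteq> 0\<close> by (simp add: c_def m field_simps flip: power_mult_distrib)
    finally show "(LINT x|lborel. u x * iter_deriv k \<psi> x) = (-1) ^ k * (LINT x|lborel. (G x + c) * \<psi> x)"
      by (simp add: Gc)
  qed
  then show thesis by (rule that)
qed

text \<open>
The fundamental lemma of the calculus of variations: a bump around a point where \<open>u\<close> and \<open>v\<close> differ
would detect the difference.
\<close>

lemma weak_deriv_0_continuous:
  assumes "weak_deriv 0 u v" and u: "continuous_on UNIV u" and v: "continuous_on UNIV v"
  shows "u x = v x"
proof (rule ccontr)
  assume "u x \<noteq> v x"
  define d where "d y = u y - v y" for y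
  have d: "continuous_on UNIV d"
    unfolding d_def by (intro continuous_intros u v)
  define h where "h y = Re (cnj (d x) * d y)" for y
  have "h x > 0"
  proof -
    have "h x = (cmod (d x))\<^sup>2"
      unfolding cmod_power2 by (simp add: h_def power2_eq_square)
    then show ?thesis using \<open>u x \<noteq> v x\<close> by (simp add: d_def)
  qed
  have h: "continuous_on UNIV h"
    unfolding h_def by (intro continuous_intros d)
  then have "open (h -` {0<..})"
    by (rule open_vimage[OF open_greaterThan])
  then obtain e where e: "e > 0" "ball x e \<subseteq> h -` {0<..}"
    using \<open>h x > 0\<close> by (auto elim: openE)
  define \<psi> where "\<psi> y = bump (x - e) (x + e) y" for y
  have \<psi>: "test_function (\<lambda>y. of_real (\<psi> y))"
    unfolding \<psi>_def by (rule test_function_bump)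
  note int = integrable_times_test_function[OF u \<psi>, of 0] integrable_times_test_function[OF v \<psi>, of 0]
    integrable_times_test_function[OF d \<psi>, of 0]
  have "(LINT y|lborel. d y * of_real (\<psi> y)) = 0"
    using assms(1) \<psi> int by (simp add: weak_deriv_def d_def left_diff_distrib)
  then have "(LINT y|lborel. cnj (d x) * (d y * of_real (\<psi> y))) = 0"
    by simp
  moreover have int': "integrable lborel (\<lambda>y. cnj (d x) * (d y * of_real (\<psi> y)))"
    using int(3) by simp
  moreover have h_eq: "h y * \<psi> y = Re (cnj (d x) * (d y * of_real (\<psi> y)))" for y
    by (simp add: h_def algebra_simps)
  ultimately have zero: "(LINT y|lborel. h y * \<psi> y) = 0" and int_h: "integrable lborel (\<lambda>y. h y * \<psi> y)"
    by (simp_all only: h_eq integral_Re integrable_Re zero_complex.sel)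
  have pos: "h y * \<psi> y > 0" if "y \<in> {x-e<..<x+e}" for y
  proof -
    have "y \<in> ball x e" using that by (auto simp: dist_real_def)
    then show ?thesis using e that by (auto simp: \<psi>_def intro!: mult_pos_pos bump_pos)
  qed
  have nonneg: "h y * \<psi> y \<ge> 0" for y
    using pos[of y] by (cases "y \<in> {x-e<..<x+e}") (auto simp: \<psi>_def bump_eq_0 not_less)
  have "AE y in lborel. h y * \<psi> y = 0"
    using integral_nonneg_eq_0_iff_AE[OF int_h] nonneg zero by simp
  then have "AE y in lborel. y \<notin> {x-e<..<x+e}"
    by eventually_elim (use pos in force)
  then have "emeasure lborel {y. \<not> y \<notin> {x-e<..<x+e}} = 0"
    by (subst (asm) AE_iff_measurable[OF _ refl]) auto
  also have "{y. \<not> y \<notin> {x-e<..<x+e}} = {x-e<..<x+e}" by auto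
  finally show False using e by simp
qed

primrec lipschitz_deriv :: "nat \<Rightarrow> (real \<Rightarrow> complex) \<Rightarrow> bool" where
  "lipschitz_deriv 0 f \<longleftrightarrow> (\<exists>L. L-lipschitz_on UNIV f)"
| "lipschitz_deriv (Suc k) f \<longleftrightarrow>
     (\<exists>f'. (\<forall>x. (f has_vector_derivative f' x) (at x)) \<and> lipschitz_deriv k f')"

lemma lipschitz_deriv_continuous:
  assumes "lipschitz_deriv k f"
  shows "continuous_on UNIV f"
proof (cases k)
  case 0
  then show ?thesis using assms lipschitz_on_continuous_on by auto
next
  case (Suc i)
  then obtain f' where "\<And>x. (f has_vector_derivative f' x) (at x)"
    using assms by auto
  then show ?thesis
    by (meson has_vector_derivative_continuous continuous_at_imp_continuous_on)
qed

lemma lipschitz_primitive_exists: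
  fixes g :: "real \<Rightarrow> complex"
  assumes "L_infty g"
  obtains G where "\<And>a b. set_integrable lborel {a..b} g"
    "\<And>x y. x \<le> y \<Longrightarrow> G y - G x = (LINT t:{x..y}|lborel. g t)" "lipschitz_deriv 0 G"
proof -
  obtain B0 where B0: "AE x in lborel. cmod (g x) \<le> B0" and [measurable]: "g \<in> borel_measurable lborel"
    using assms by (auto simp: L_infty_def)
  define B where "B = \<bar>B0\<bar>"
  have B: "AE x in lborel. cmod (g x) \<le> B" "B \<ge> 0"
    using B0 by (auto simp: B_def elim!: eventually_mono)
  have const: "integrable lborel (\<lambda>x. indicator {a..b} x * B)" for a b :: real
    by (intro integrable_mult_left integrable_real_indicator) (auto simp: emeasure_lborel_Icc_eq)
  have bound: "AE x in lborel. cmod (indicator {a..b} x *\<^sub>R g x) \<le> indicator {a..b} x * B" for a b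
    using B(1) by eventually_elim (auto simp: indicator_def)
  have int: "set_integrable lborel {a..b} g" for a b
    unfolding set_integrable_def
  proof (rule Bochner_Integration.integrable_bound[OF const])
    show "AE x in lborel. cmod (indicator {a..b} x *\<^sub>R g x) \<le> norm (indicator {a..b} x * B)"
      using bound[of a b] by eventually_elim (use B(2) in auto)
  qed measurable
  have int': "interval_lebesgue_integrable lborel (ereal a) (ereal b) g" for a b
    unfolding interval_lebesgue_integrable_def
    by (auto intro: set_integrable_subset[OF int[of a b]] set_integrable_subset[OF int[of b a]])
  define G where "G x = (LBINT t=ereal 0..ereal x. g t)" for x
  have diff: "G y - G x = (LINT t:{x..y}|lborel. g t)" if "x \<le> y" for x y
  proof -
    have "min (ereal 0) (min (ereal x) (ereal y)) = ereal (min 0 (min x y))"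
      "max (ereal 0) (max (ereal x) (ereal y)) = ereal (max 0 (max x y))"
      by (simp_all add: ereal_min ereal_max)
    then have "G x + (LBINT t=ereal x..ereal y. g t) = G y"
      unfolding G_def by (intro interval_integral_sum) (simp only: int')
    then show ?thesis
      using interval_integral_Icc[OF that, of g] by (simp add: algebra_simps)
  qed
  have norm_le: "cmod (G y - G x) \<le> B * (y - x)" if "x \<le> y" for x y
  proof -
    have "cmod (G y - G x) \<le> (LINT t:{x..y}|lborel. cmod (g t))"
      unfolding diff[OF that] by (rule set_integral_norm_bound[OF int])
    also have "\<dots> \<le> (LINT t|lborel. indicator {x..y} t * B)"
      unfolding set_lebesgue_integral_def
      by (rule integral_mono_AE)
         (use int[of x y] const bound[of x y] in \<open>auto simp: set_integrable_def dest: integrable_norm\<close>)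
    also have "\<dots> = B * (y - x)"
      using that by simp
    finally show ?thesis .
  qed
  have "B-lipschitz_on UNIV G"
  proof (rule lipschitz_onI)
    fix x y :: real
    show "dist (G x) (G y) \<le> B * dist x y"
      using norm_le[of x y] norm_le[of y x]
      by (cases "x \<le> y") (auto simp: dist_norm norm_minus_commute)
  qed (rule B(2))
  then have "lipschitz_deriv 0 G" by auto
  with int diff show thesis by (rule that)
qed

text \<open>
Lowering the order of the weak derivative one step at a time replaces \<open>v\<close> by an iterated primitive,
which at order zero coincides with \<open>u\<close>.
\<close>

lemma weak_deriv_imp_lipschitz_deriv:
  assumes "weak_deriv k u v" and u: "continuous_on UNIV u" and "lipschitz_deriv j v"
  shows "lipschitz_deriv (j + k) u"
  using assms(1,3)
proof (induction k arbitrary: j v)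
  case 0
  have "u = v"
    using weak_deriv_0_continuous[OF 0(1) u lipschitz_deriv_continuous[OF 0(2)]] by blast
  then show ?case using 0 by simp
next
  case (Suc k)
  have v: "continuous_on UNIV v"
    by (rule lipschitz_deriv_continuous[OF Suc.prems(2)])
  obtain V where V: "\<And>x. (V has_vector_derivative v x) (at x)"
    using antiderivative_exists[OF v] by blast
  have "set_integrable lborel {a..b} v" for a b
    by (intro borel_integrable_atLeastAtMost' continuous_on_subset[OF v]) auto
  moreover have "continuous_on UNIV V"
    using V has_vector_derivative_continuous continuous_at_imp_continuous_on by blast
  ultimately obtain c where "weak_deriv k u (\<lambda>x. V x + c)"
    using weak_deriv_lower[OF Suc.prems(1) u, of V] integral_derivative_Icc[OF V v] by metis
  moreover have "lipschitz_deriv (Suc j) (\<lambda>x. V x + c)"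
    using V Suc.prems(2)
    by (auto intro!: exI[of _ v] simp: has_vector_derivative_add_const)
  ultimately show ?case using Suc.IH[of "\<lambda>x. V x + c" "Suc j"] by simp
qed

primrec bounded_lipschitz_deriv :: "nat \<Rightarrow> (real \<Rightarrow> complex) \<Rightarrow> bool" where
  "bounded_lipschitz_deriv 0 f \<longleftrightarrow> bounded (range f) \<and> (\<exists>L. L-lipschitz_on UNIV f)"
| "bounded_lipschitz_deriv (Suc k) f \<longleftrightarrow> bounded (range f) \<and>
     (\<exists>f'. (\<forall>x. (f has_vector_derivative f' x) (at x)) \<and> bounded_lipschitz_deriv k f')"

lemma bounded_derivative_of_lipschitz:
  fixes f :: "real \<Rightarrow> complex"
  assumes "L-lipschitz_on UNIV f" and "(f has_vector_derivative d) (at x)"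
  shows "cmod d \<le> L"
proof -
  have "((\<lambda>y. norm (f y - f x - (y - x) *\<^sub>R d) / norm (y - x) + L) \<longlongrightarrow> 0 + L) (at x)"
    using assms(2) by (intro tendsto_intros) (simp add: has_vector_derivative_def has_derivative_iff_norm)
  moreover have "cmod d \<le> norm (f y - f x - (y - x) *\<^sub>R d) / norm (y - x) + L" if "y \<noteq> x" for y
  proof -
    have "\<bar>y - x\<bar> * cmod d = norm ((y - x) *\<^sub>R d)" by simp
    also have "\<dots> \<le> norm (f y - f x - (y - x) *\<^sub>R d) + norm (f y - f x)"
      using norm_triangle_ineq4[of "f y - f x" "f y - f x - (y - x) *\<^sub>R d"] by simp
    also have "norm (f y - f x) \<le> L * \<bar>y - x\<bar>"
      using lipschitz_onD[OF assms(1), of y x] by (simp add: dist_norm)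
    finally show ?thesis using that by (simp add: field_simps)
  qed
  ultimately have "cmod d \<le> 0 + L"
    by (intro tendsto_lowerbound) (auto simp: eventually_at_filter)
  then show ?thesis by simp
qed

text \<open>
Boundedness of the \<open>k\<close>-th derivative for \<open>1 \<le> k \<le> K\<close> comes from the Lipschitz bound of the derivative
of order \<open>k - 1\<close>; hence the hypothesis for all orders, not only for \<open>K\<close>.
\<close>

lemma bounded_lipschitz_derivI:
  assumes "bounded (range f)" and "\<And>k. k \<le> K \<Longrightarrow> lipschitz_deriv k f"
  shows "bounded_lipschitz_deriv K f"
  using assms
proof (induction K arbitrary: f)
  case 0
  then show ?case using 0(2)[of 0] by simp
next
  case (Suc K)
  obtain f' where f': "\<And>x. (f has_vector_derivative f' x) (at x)"
    using Suc.prems(2)[of "Suc K"] by auto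
  obtain L where L: "L-lipschitz_on UNIV f"
    using Suc.prems(2)[of 0] by auto
  have "bounded (range f')"
    using bounded_derivative_of_lipschitz[OF L f'] by (auto simp: bounded_iff)
  moreover have "lipschitz_deriv k f'" if k: "k \<le> K" for k
  proof -
    obtain g where g: "\<And>x. (f has_vector_derivative g x) (at x)" "lipschitz_deriv k g"
      using Suc.prems(2)[of "Suc k"] k by auto
    have "g = f'"
      using vector_derivative_unique_at[OF g(1) f'] by blast
    then show ?thesis using g by simp
  qed
  ultimately have "bounded_lipschitz_deriv K f'"
    by (rule Suc.IH)
  then show ?case using Suc.prems(1) f' by auto
qed

text \<open>
The weak derivative of order \<open>k + 1\<close> is only measurable and bounded, but its primitive is Lipschitz and,
up to a constant, the weak derivative of order \<open>k\<close>. From there on everything is continuous and classical.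
\<close>

lemma W_infty_bounded_lipschitz_deriv:
  assumes "N \<ge> 1" and W: "W_infty N q" and q: "continuous_on UNIV q"
  shows "bounded_lipschitz_deriv (N - 1) q"
proof (rule bounded_lipschitz_derivI)
  obtain B where B: "AE x in lborel. cmod (q x) \<le> B"
    using W by (auto simp: W_infty_def L_infty_def)
  have "cmod (q x) \<le> B" for x
  proof (rule ccontr)
    assume "\<not> cmod (q x) \<le> B"
    have "open ((\<lambda>y. cmod (q y)) -` {B<..})"
      by (intro open_vimage open_greaterThan continuous_intros q)
    moreover have "x \<in> (\<lambda>y. cmod (q y)) -` {B<..}"
      using \<open>\<not> cmod (q x) \<le> B\<close> by simp
    ultimately obtain e where e: "e > 0" "ball x e \<subseteq> (\<lambda>y. cmod (q y)) -` {B<..}"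
      by (rule openE)
    have "AE y in lborel. y \<notin> ball x e"
      using B by eventually_elim (use e in force)
    then have "emeasure lborel {y. \<not> y \<notin> ball x e} = 0"
      by (subst (asm) AE_iff_measurable[OF _ refl]) auto
    also have "{y. \<not> y \<notin> ball x e} = {x-e<..<x+e}"
      by (auto simp: dist_real_def)
    finally show False using e by simp
  qed
  then show "bounded (range q)"
    by (auto simp: bounded_iff)
next
  fix k assume "k \<le> N - 1"
  then have "Suc k \<in> {1..N}" using \<open>N \<ge> 1\<close> by auto
  then obtain g where g: "L_infty g" "weak_deriv (Suc k) q g"
    using W unfolding W_infty_def by blast
  obtain G where G: "\<And>a b. set_integrable lborel {a..b} g"
    "\<And>x y. x \<le> y \<Longrightarrow> G y - G x = (LINT t:{x..y}|lborel. g t)" "lipschitz_deriv 0 G"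
    using lipschitz_primitive_exists[OF g(1)] by blast
  obtain c where c: "weak_deriv k q (\<lambda>x. G x + c)"
    using weak_deriv_lower[OF g(2) q G(1,2) lipschitz_deriv_continuous[OF G(3)]] by blast
  have "lipschitz_deriv 0 (\<lambda>x. G x + c)"
    using G(3) by (auto simp: lipschitz_on_def)
  then show "lipschitz_deriv k q"
    using weak_deriv_imp_lipschitz_deriv[OF c q, of 0] by simp
qed

section \<open>Bounded functions with a Lipschitz derivative\<close>

lemma increment_bound:
  fixes f f' :: "real \<Rightarrow> complex"
  assumes "\<And>x. (f has_vector_derivative f' x) (at x)" and "\<And>x. x \<in> {a..b} \<Longrightarrow> cmod (f' x) \<le> C"
    and "a \<le> b"
  shows "cmod (f b - f a) \<le> C * (b - a)"
proof -
  have "C \<ge> 0" using assms(2)[of a] assms(3) norm_ge_zero[of "f' a"] by (simp del: norm_ge_zero)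
  have "C-lipschitz_on {a..b} f"
  proof (rule bounded_derivative_imp_lipschitz)
    fix x assume "x \<in> {a..b}"
    show "(f has_derivative (\<lambda>h. h *\<^sub>R f' x)) (at x within {a..b})"
      using assms(1)[of x] has_derivative_at_withinI unfolding has_vector_derivative_def by blast
    show "onorm (\<lambda>h. h *\<^sub>R f' x) \<le> C"
    proof (rule onorm_le)
      fix h :: real
      show "norm (h *\<^sub>R f' x) \<le> C * norm h"
        using mult_right_mono[OF assms(2)[OF \<open>x \<in> {a..b}\<close>], of "\<bar>h\<bar>"] by (simp add: mult.commute)
    qed
  qed (use \<open>C \<ge> 0\<close> in auto)
  then show ?thesis
    using lipschitz_onD[of C "{a..b}" f b a] assms(3) by (simp add: dist_norm)
qed

lemma bounded_range_iff:
  "bounded (range f) \<longleftrightarrow> (\<exists>B\<ge>0. \<forall>x::real. cmod (f x) \<le> B)"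
proof
  assume "bounded (range f)"
  then obtain B where "\<And>x. cmod (f x) \<le> B" by (auto simp: bounded_iff)
  then show "\<exists>B\<ge>0. \<forall>x. cmod (f x) \<le> B"
    using norm_ge_zero order_trans by blast
qed (auto simp: bounded_iff)

lemma lipschitz_iff:
  "(\<exists>L. L-lipschitz_on UNIV f) \<longleftrightarrow> (\<exists>L\<ge>0. \<forall>x y::real. cmod (f x - f y) \<le> L * \<bar>x - y\<bar>)"
  by (auto simp: lipschitz_on_def dist_norm)

lemma bounded_lipschitz_deriv_bounded:
  "bounded_lipschitz_deriv k f \<Longrightarrow> bounded (range f)"
  by (cases k) auto

lemma bounded_lipschitz_deriv_SucI:
  assumes "bounded (range f)" "\<And>x. (f has_vector_derivative f' x) (at x)" "bounded_lipschitz_deriv k f'"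
  shows "bounded_lipschitz_deriv (Suc k) f"
  unfolding bounded_lipschitz_deriv.simps
  by (intro conjI exI[of _ f'] allI assms)

lemma bounded_lipschitz_deriv_Suc_imp:
  "bounded_lipschitz_deriv (Suc k) f \<Longrightarrow> bounded_lipschitz_deriv k f"
proof (induction k arbitrary: f)
  case 0
  then obtain f' where f': "\<And>x. (f has_vector_derivative f' x) (at x)" "bounded (range f')"
    by auto
  obtain B where B: "B \<ge> 0" "\<And>x. cmod (f' x) \<le> B"
    using f'(2) by (auto simp: bounded_range_iff)
  have "cmod (f x - f y) \<le> B * \<bar>x - y\<bar>" for x y
    using increment_bound[OF f'(1) B(2), of x y] increment_bound[OF f'(1) B(2), of y x]
    by (cases "x \<le> y") (auto simp: norm_minus_commute)
  then show ?case using 0 B(1) by (auto simp: lipschitz_iff)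
next
  case (Suc k)
  obtain f' where f': "\<And>x. (f has_vector_derivative f' x) (at x)" "bounded_lipschitz_deriv (Suc k) f'"
    using Suc.prems by (auto simp del: bounded_lipschitz_deriv.simps(2)
        simp: bounded_lipschitz_deriv.simps(2)[of "Suc k"])
  from Suc.IH[OF f'(2)] f'(1) bounded_lipschitz_deriv_bounded[OF Suc.prems] show ?case by auto
qed

lemma bounded_lipschitz_deriv_mono:
  "bounded_lipschitz_deriv k f \<Longrightarrow> j \<le> k \<Longrightarrow> bounded_lipschitz_deriv j f"
  by (rotate_tac, induction rule: inc_induct) (auto dest: bounded_lipschitz_deriv_Suc_imp simp del: bounded_lipschitz_deriv.simps)

lemma bounded_lipschitz_deriv_const: "bounded_lipschitz_deriv k (\<lambda>x. c)"
proof (induction k arbitrary: c)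
  case 0
  show ?case by (auto simp: lipschitz_iff bounded_range_iff intro: exI[of _ "cmod c"])
next
  case (Suc k)
  then show ?case by (auto intro!: exI[of _ "\<lambda>x. 0"] simp: bounded_range_iff)
qed

lemma bounded_range_add:
  assumes "bounded (range f)" "bounded (range g)"
  shows "bounded (range (\<lambda>x::real. f x + g x :: complex))"
proof -
  obtain A B where "\<forall>x. cmod (f x) \<le> A" "\<forall>x. cmod (g x) \<le> B"
    using assms by (auto simp: bounded_range_iff)
  then have "cmod (f x + g x) \<le> A + B" for x
    by (simp add: norm_triangle_mono)
  then show ?thesis by (auto simp: bounded_iff)
qed

lemma bounded_range_mult:
  assumes "bounded (range f)" "bounded (range g)"
  shows "bounded (range (\<lambda>x::real. f x * g x :: complex))"
proof -
  obtain A B where "\<forall>x. cmod (f x) \<le> A" "A \<ge> 0" "\<forall>x. cmod (g x) \<le> B"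
    using assms by (auto simp: bounded_range_iff)
  then have "cmod (f x * g x) \<le> A * B" for x
    unfolding norm_mult by (intro mult_mono) auto
  then show ?thesis by (auto simp: bounded_iff)
qed

lemma bounded_lipschitz_deriv_add:
  "bounded_lipschitz_deriv k f \<Longrightarrow> bounded_lipschitz_deriv k g \<Longrightarrow>
    bounded_lipschitz_deriv k (\<lambda>x. f x + g x)"
proof (induction k arbitrary: f g)
  case 0
  obtain L M where L: "L \<ge> 0" "\<And>x y. cmod (f x - f y) \<le> L * \<bar>x - y\<bar>"
    and M: "M \<ge> 0" "\<And>x y. cmod (g x - g y) \<le> M * \<bar>x - y\<bar>"
    using 0 by (auto simp: lipschitz_iff)
  have "cmod (f x + g x - (f y + g y)) \<le> (L + M) * \<bar>x - y\<bar>" for x y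
    using norm_triangle_mono[OF L(2)[of x y] M(2)[of x y]]
    by (simp add: distrib_right add_diff_add)
  then have "\<exists>L. L-lipschitz_on UNIV (\<lambda>x. f x + g x)"
    using L(1) M(1) unfolding lipschitz_iff by (intro exI[of _ "L + M"]) auto
  then show ?case using 0 by (simp add: bounded_range_add)
next
  case (Suc k)
  then obtain f' g' where "\<And>x. (f has_vector_derivative f' x) (at x)" "bounded_lipschitz_deriv k f'"
    "\<And>x. (g has_vector_derivative g' x) (at x)" "bounded_lipschitz_deriv k g'" by auto
  then show ?case
    using Suc by (auto intro!: bounded_range_add exI[of _ "\<lambda>x. f' x + g' x"] has_vector_derivative_add)
qed

lemma bounded_lipschitz_deriv_mult:
  "bounded_lipschitz_deriv k f \<Longrightarrow> bounded_lipschitz_deriv k g \<Longrightarrow>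
    bounded_lipschitz_deriv k (\<lambda>x. f x * g x)"
proof (induction k arbitrary: f g)
  case 0
  obtain L M where L: "L \<ge> 0" "\<And>x y. cmod (f x - f y) \<le> L * \<bar>x - y\<bar>"
    and M: "M \<ge> 0" "\<And>x y. cmod (g x - g y) \<le> M * \<bar>x - y\<bar>"
    using 0 by (auto simp: lipschitz_iff)
  obtain A B where A: "A \<ge> 0" "\<And>x. cmod (f x) \<le> A" and B: "B \<ge> 0" "\<And>x. cmod (g x) \<le> B"
    using 0 by (auto simp: bounded_range_iff)
  have "cmod (f x * g x - f y * g y) \<le> (A * M + L * B) * \<bar>x - y\<bar>" for x y
  proof -
    have "f x * g x - f y * g y = f x * (g x - g y) + (f x - f y) * g y"
      by (simp add: algebra_simps)
    also have "cmod \<dots> \<le> A * (M * \<bar>x - y\<bar>) + (L * \<bar>x - y\<bar>) * B"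
      by (rule norm_triangle_mono; unfold norm_mult; rule mult_mono) (use A B L M in auto)
    finally show ?thesis by (simp add: algebra_simps)
  qed
  then have "\<exists>L. L-lipschitz_on UNIV (\<lambda>x. f x * g x)"
    using A B L M unfolding lipschitz_iff by (intro exI[of _ "A * M + L * B"]) auto
  then show ?case using 0 by (simp add: bounded_range_mult)
next
  case (Suc k)
  then obtain f' g' where f': "\<And>x. (f has_vector_derivative f' x) (at x)" "bounded_lipschitz_deriv k f'"
    and g': "\<And>x. (g has_vector_derivative g' x) (at x)" "bounded_lipschitz_deriv k g'" by auto
  have reg: "bounded_lipschitz_deriv k (\<lambda>x. f x * g' x + f' x * g x)"
    using Suc.prems[THEN bounded_lipschitz_deriv_Suc_imp] f' g'
    by (intro bounded_lipschitz_deriv_add Suc.IH)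
  have deriv: "((\<lambda>x. f x * g x) has_vector_derivative f x * g' x + f' x * g x) (at x)" for x
    by (intro has_vector_derivative_mult f' g')
  have "bounded (range (\<lambda>x. f x * g x))"
    using Suc.prems by (intro bounded_range_mult bounded_lipschitz_deriv_bounded)
  then show ?case
    by (rule bounded_lipschitz_deriv_SucI[OF _ deriv reg])
qed

lemma bounded_lipschitz_deriv_sum:
  "(\<And>i. i \<in> I \<Longrightarrow> bounded_lipschitz_deriv k (f i)) \<Longrightarrow>
    bounded_lipschitz_deriv k (\<lambda>x. \<Sum>i\<in>I. f i x)"
  by (induction I rule: infinite_finite_induct)
     (auto intro: bounded_lipschitz_deriv_add bounded_lipschitz_deriv_const)

lemma bounded_lipschitz_deriv_cnj:
  "bounded_lipschitz_deriv k f \<Longrightarrow> bounded_lipschitz_deriv k (\<lambda>x. cnj (f x))"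
proof (induction k arbitrary: f)
  case 0
  then have "\<exists>L. L-lipschitz_on UNIV (\<lambda>x. cnj (f x))"
    by (auto simp: lipschitz_on_def dist_norm simp flip: complex_cnj_diff)
  then show ?case using 0 by (auto simp: bounded_iff)
next
  case (Suc k)
  then obtain f' where f': "\<And>x. (f has_vector_derivative f' x) (at x)" "bounded_lipschitz_deriv k f'"
    by auto
  have deriv: "((\<lambda>x. cnj (f x)) has_vector_derivative cnj (f' x)) (at x)" for x
    by (rule bounded_linear.has_vector_derivative[OF bounded_linear_cnj f'(1)])
  have "bounded (range (\<lambda>x. cnj (f x)))"
    using bounded_lipschitz_deriv_bounded[OF Suc.prems] by (simp add: bounded_iff)
  then show ?case
    by (rule bounded_lipschitz_deriv_SucI[OF _ deriv Suc.IH[OF f'(2)]])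
qed

lemma bounded_lipschitz_deriv_derivative:
  assumes "bounded_lipschitz_deriv (Suc k) f"
  shows "(f has_vector_derivative vector_derivative f (at x)) (at x)"
    and "bounded_lipschitz_deriv k (\<lambda>x. vector_derivative f (at x))"
proof -
  obtain f' where f': "\<And>x. (f has_vector_derivative f' x) (at x)" "bounded_lipschitz_deriv k f'"
    using assms by auto
  then have "(\<lambda>x. vector_derivative f (at x)) = f'"
    by (auto simp: vector_derivative_at)
  with f' show "(f has_vector_derivative vector_derivative f (at x)) (at x)"
    "bounded_lipschitz_deriv k (\<lambda>x. vector_derivative f (at x))"
    by (simp_all add: fun_eq_iff)
qed

text \<open>
Each step of the recursion costs one derivative.
\<close>

lemma dirac_coeff_regular:
  assumes q: "bounded_lipschitz_deriv K q"
  shows "1 \<le> j \<Longrightarrow> j \<le> Suc K \<Longrightarrow> bounded_lipschitz_deriv (Suc K - j) (dirac_coeff q j)"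
proof (induction j rule: less_induct)
  case (less j)
  consider "j = 1" | i where "j = Suc (Suc i)"
    using less.prems(1) by (metis One_nat_def Suc_le_D le_zero_eq not0_implies_Suc)
  then show ?case
  proof cases
    case 1
    have "bounded_lipschitz_deriv K (\<lambda>x. (1 / 2) * cnj (q x))"
      by (intro bounded_lipschitz_deriv_mult bounded_lipschitz_deriv_const bounded_lipschitz_deriv_cnj q)
    then show ?thesis using 1 by simp
  next
    case 2
    define k where "k = K - Suc i"
    have k: "Suc K - j = k" "Suc K - Suc i = Suc k" "Suc i \<le> K"
      using 2 less.prems by (auto simp: k_def)
    have "bounded_lipschitz_deriv (Suc k) (dirac_coeff q (Suc i))"
      using less.IH[of "Suc i"] 2 k by simp
    then have "bounded_lipschitz_deriv k (\<lambda>x. vector_derivative (dirac_coeff q (Suc i)) (at x))"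
      by (rule bounded_lipschitz_deriv_derivative)
    moreover have c: "bounded_lipschitz_deriv k (dirac_coeff q l)" if "l \<in> {1..i}" for l
    proof (rule bounded_lipschitz_deriv_mono)
      show "bounded_lipschitz_deriv (Suc K - l) (dirac_coeff q l)"
        using less.IH[of l] 2 that less.prems(2) by simp
      show "k \<le> Suc K - l"
        using that unfolding k_def atLeastAtMost_iff by linarith
    qed
    moreover have "bounded_lipschitz_deriv k (\<lambda>x. q x)"
      by (rule bounded_lipschitz_deriv_mono[OF q]) (simp add: k_def)
    ultimately have "bounded_lipschitz_deriv k (\<lambda>x.
        (- (\<i> / 2)) * vector_derivative (dirac_coeff q (Suc i)) (at x)
        + ((1 / 2) * q x) * (\<Sum>l = 1..i. dirac_coeff q l x * dirac_coeff q (Suc i - l) x))"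
      by (intro bounded_lipschitz_deriv_add bounded_lipschitz_deriv_mult bounded_lipschitz_deriv_const
          bounded_lipschitz_deriv_sum c) auto
    then show ?thesis using 2 k by simp
  qed
qed

section \<open>Comparison for the Riccati equation\<close>

text \<open>
Otherwise \<open>g - \<beta> / \<alpha>\<close> would grow exponentially from a point where it is positive.
\<close>

lemma bounded_above_growth:
  fixes g g' :: "real \<Rightarrow> real"
  assumes deriv: "\<And>x. (g has_real_derivative g' x) (at x)"
    and growth: "\<And>x. \<alpha> * g x - \<beta> \<le> g' x" and "\<alpha> > 0" and bound: "\<And>x. g x \<le> M"
  shows "g x \<le> \<beta> / \<alpha>"
proof (rule ccontr)
  assume "\<not> g x \<le> \<beta> / \<alpha>"
  define h where "h y = (g y - \<beta> / \<alpha>) * exp (- \<alpha> * y)" for y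
  have h: "(h has_real_derivative (g' y - \<alpha> * g y + \<beta>) * exp (- \<alpha> * y)) (at y)" for y
    unfolding h_def using \<open>\<alpha> > 0\<close>
    by (auto intro!: derivative_eq_intros deriv simp: field_simps)
  have mono: "h x \<le> h y" if "x \<le> y" for y
  proof (rule DERIV_nonneg_imp_nondecreasing[OF that])
    fix t show "\<exists>d. (h has_real_derivative d) (at t) \<and> 0 \<le> d"
      by (intro exI[of _ "(g' t - \<alpha> * g t + \<beta>) * exp (- \<alpha> * t)"] conjI h) (use growth[of t] in auto)
  qed
  have "h x > 0"
    using \<open>\<not> g x \<le> \<beta> / \<alpha>\<close> by (simp add: h_def)
  have "filterlim (\<lambda>y. exp (\<alpha> * y)) at_top at_top"
    by (rule filterlim_compose[OF exp_at_top])
       (use \<open>\<alpha> > 0\<close> filterlim_tendsto_pos_mult_at_top[OF tendsto_const _ filterlim_ident] in blast)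
  then have "\<forall>\<^sub>F y in at_top. exp (\<alpha> * y) \<ge> (M - \<beta> / \<alpha>) / h x + 1"
    by (simp add: filterlim_at_top)
  with eventually_ge_at_top[of x]
  have "\<forall>\<^sub>F y in at_top. x \<le> y \<and> exp (\<alpha> * y) \<ge> (M - \<beta> / \<alpha>) / h x + 1"
    by eventually_elim simp
  then obtain y where y: "x \<le> y" "exp (\<alpha> * y) \<ge> (M - \<beta> / \<alpha>) / h x + 1"
    using eventually_happens[OF _] by (metis (no_types, lifting) trivial_limit_at_top_linorder)
  have "M - \<beta> / \<alpha> < h x * ((M - \<beta> / \<alpha>) / h x + 1)"
    using \<open>h x > 0\<close> by (simp add: distrib_left)
  also have "\<dots> \<le> h x * exp (\<alpha> * y)"
    using y(2) \<open>h x > 0\<close> by (intro mult_left_mono) auto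
  also have "\<dots> \<le> h y * exp (\<alpha> * y)"
    using mono[OF y(1)] by (intro mult_right_mono) auto
  also have "\<dots> = g y - \<beta> / \<alpha>"
    by (simp add: h_def mult.assoc flip: exp_add)
  finally show False using bound[of y] by simp
qed

lemma has_derivative_cmod_square:
  assumes "(f has_vector_derivative f') (at x)"
  shows "((\<lambda>x. (cmod (f x))\<^sup>2) has_real_derivative 2 * Re (cnj (f x) * f')) (at x)"
proof -
  have Re: "((\<lambda>x. Re (f x)) has_real_derivative Re f') (at x)"
    and Im: "((\<lambda>x. Im (f x)) has_real_derivative Im f') (at x)"
    using assms unfolding has_vector_derivative_complex_iff by blast+
  from DERIV_add[OF DERIV_power[OF Re, of 2] DERIV_power[OF Im, of 2]] show ?thesis
    unfolding cmod_power2 by (rule DERIV_cong) (simp add: algebra_simps)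
qed

text \<open>
The right-hand side of the equation \<open>m' = 2 \<i> z m - \<i> (cnj q + q m\<^sup>2)\<close> for quotients \<open>f\<^sub>2 / f\<^sub>1\<close>.
\<close>

definition riccati :: "(real \<Rightarrow> complex) \<Rightarrow> complex \<Rightarrow> (real \<Rightarrow> complex) \<Rightarrow> real \<Rightarrow> complex" where
  "riccati q z m x = 2 * \<i> * z * m x - \<i> * (cnj (q x) + q x * (m x)\<^sup>2)"

text \<open>
This computes \<open>(\<bar>m\<bar>\<^sup>2)'\<close> along the equation with residual \<open>\<rho>\<close>. The potential enters only through
\<open>Im (Q m)\<close> times \<open>1 - \<bar>m\<bar>\<^sup>2\<close>, that is, as a contribution to the logarithmic derivative of \<open>1 - \<bar>m\<bar>\<^sup>2\<close>;
this is what cancels against the next identity.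
\<close>

lemma defect_identity:
  "2 * Re (cnj m * (2 * \<i> * z * m - \<i> * (cnj Q + Q * m\<^sup>2) - \<rho>))
     = - 4 * Im z * (cmod m)\<^sup>2 - 2 * Im (Q * m) * (1 - (cmod m)\<^sup>2) - 2 * Re (cnj m * \<rho>)"
  unfolding cmod_power2 power2_eq_square[of m] by (simp add: power2_eq_square) (simp add: algebra_simps)

lemma defect_identity_exact:
  "2 * Re (cnj m * (2 * \<i> * z * m - \<i> * (cnj Q + Q * m\<^sup>2)))
     = - 4 * Im z * (cmod m)\<^sup>2 - 2 * Im (Q * m) * (1 - (cmod m)\<^sup>2)"
  using defect_identity[of m z Q 0] by (simp only: diff_zero mult_zero_right zero_complex.sel)

text \<open>
The derivative of \<open>\<bar>m - p\<bar>\<^sup>2\<close>: its logarithmic derivative contains \<open>Im (Q m) + Im (Q p)\<close>, the same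
terms as those of \<open>1 - \<bar>m\<bar>\<^sup>2\<close> and \<open>1 - \<bar>p\<bar>\<^sup>2\<close> together.
\<close>

lemma difference_identity:
  "2 * Re (cnj (m - p) * ((2 * \<i> * z * m - \<i> * (cnj Q + Q * m\<^sup>2)) - (2 * \<i> * z * p - \<i> * (cnj Q + Q * p\<^sup>2) - \<rho>)))
     = (- 4 * Im z + 2 * Im (Q * m) + 2 * Im (Q * p)) * (cmod (m - p))\<^sup>2 + 2 * Re (cnj (m - p) * \<rho>)"
proof -
  define r where "r = m - p"
  define w where "w = 2 * \<i> * z - \<i> * (Q * m + Q * p)"
  have eq: "(2 * \<i> * z * m - \<i> * (cnj Q + Q * m\<^sup>2)) - (2 * \<i> * z * p - \<i> * (cnj Q + Q * p\<^sup>2) - \<rho>)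
      = w * r + \<rho>"
    unfolding w_def r_def by (simp add: algebra_simps power2_eq_square)
  have combine: "a = c * d + e \<Longrightarrow> c = - 2 * u + v + v' \<Longrightarrow> 2 * a = (- 4 * u + 2 * v + 2 * v') * d + 2 * e"
    for a c d e u v v' :: real
    by (simp add: algebra_simps)
  show ?thesis
    unfolding eq r_def[symmetric]
  proof (rule combine)
    show "Re (cnj r * (w * r + \<rho>)) = Re w * (cmod r)\<^sup>2 + Re (cnj r * \<rho>)"
      unfolding cmod_power2 by (simp add: power2_eq_square algebra_simps)
    show "Re w = - 2 * Im z + Im (Q * m) + Im (Q * p)"
      by (simp add: w_def)
  qed
qed

text \<open>
If \<open>1 - \<bar>m\<bar>\<^sup>2\<close> were very small at one point, the equation would drive it below zero further to the
right. The bound degenerates as \<open>Im z\<close> tends to zero, but it is only used to see that a certain function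
is bounded for fixed \<open>z\<close>.
\<close>

lemma disc_defect_lower_bound:
  assumes m: "\<And>x. (m has_vector_derivative riccati q z m x) (at x)"
    and disc: "\<And>x. cmod (m x) < 1" and z: "Im z < 0"
    and q: "\<And>x. cmod (q x) \<le> B"
  shows "1 - (cmod (m x))\<^sup>2 \<ge> (- 4 * Im z) / (- 4 * Im z + 2 * B)"
proof -
  define u where "u x = 1 - (cmod (m x))\<^sup>2" for x
  have "B \<ge> 0" using q[of 0] norm_ge_zero order_trans by blast
  have u: "0 < u x" "u x \<le> 1" for x
    using disc[of x] by (auto simp: u_def power_less_one_iff)
  have "- u x \<le> (4 * Im z) / (- 4 * Im z + 2 * B)"
  proof (rule bounded_above_growth[where g = "\<lambda>x. - u x" and M = 0])
    fix x
    show "((\<lambda>x. - u x) has_real_derivative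
        - 4 * Im z * (cmod (m x))\<^sup>2 - 2 * Im (q x * m x) * (1 - (cmod (m x))\<^sup>2)) (at x)"
      using DERIV_diff[OF has_derivative_cmod_square[OF m[of x]] DERIV_const[of 1]]
      unfolding u_def riccati_def defect_identity_exact by simp
    have "\<bar>Im (q x * m x)\<bar> \<le> B"
    proof -
      have "\<bar>Im (q x * m x)\<bar> \<le> cmod (q x) * cmod (m x)"
        by (metis abs_Im_le_cmod norm_mult)
      also have "\<dots> \<le> B * 1"
        using q[of x] disc[of x] \<open>B \<ge> 0\<close> by (intro mult_mono) auto
      finally show ?thesis by simp
    qed
    then have "Im (q x * m x) * u x \<le> B * u x"
      using u[of x] by (intro mult_right_mono) auto
    then show "(- 4 * Im z + 2 * B) * - u x - 4 * Im z
        \<le> - 4 * Im z * (cmod (m x))\<^sup>2 - 2 * Im (q x * m x) * (1 - (cmod (m x))\<^sup>2)"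
      by (simp add: u_def algebra_simps)
    show "- u x \<le> 0" using u[of x] by simp
    show "0 < - 4 * Im z + 2 * B" using z \<open>B \<ge> 0\<close> by simp
  qed
  moreover have "(- 4 * Im z) / (- 4 * Im z + 2 * B) = - ((4 * Im z) / (- 4 * Im z + 2 * B))"
    by simp
  ultimately show ?thesis unfolding u_def by linarith
qed

text \<open>
If the hyperbolic distance of a solution and an approximate solution in the disc were large compared
with the residual over \<open>\<bar>Im z\<bar>\<close> at some point, it would grow without bound towards \<open>+\<infinity>\<close>. The
resulting estimate does not depend on the size of \<open>q\<close>.
\<close>

lemma riccati_comparison:
  assumes m: "\<And>x. (m has_vector_derivative riccati q z m x) (at x)"
    and disc: "\<And>x. cmod (m x) < 1"
    and p: "\<And>x. (p has_vector_derivative riccati q z p x - \<rho> x) (at x)"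
    and p_half: "\<And>x. cmod (p x) \<le> 1 / 2"
    and \<rho>: "\<And>x. cmod (\<rho> x) \<le> \<epsilon>" and \<epsilon>: "\<epsilon> \<le> - Im z / 2" and z: "Im z < 0"
    and q: "\<And>x. cmod (q x) \<le> B"
  shows "cmod (m x - p x) \<le> \<epsilon> / (- Im z)"
proof -
  define \<eta> where "\<eta> = - Im z"
  have \<eta>: "\<eta> > 0" "Im z = - \<eta>" using z by (auto simp: \<eta>_def)
  have "\<epsilon> \<ge> 0" using \<rho>[of 0] norm_ge_zero order_trans by blast
  have "B \<ge> 0" using q[of 0] norm_ge_zero order_trans by blast
  define u where "u x = 1 - (cmod (m x))\<^sup>2" for x
  define v where "v x = 1 - (cmod (p x))\<^sup>2" for x
  define d where "d x = (cmod (m x - p x))\<^sup>2" for x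
  \<comment> \<open>\<open>Q\<close> is the square of the hyperbolic sine of half the hyperbolic distance of \<open>m x\<close>
    and \<open>p x\<close> in the unit disc of curvature \<open>-1\<close>.\<close>
  define Q where "Q x = d x / (u x * v x)" for x
  have u: "0 < u x" "u x \<le> 1" for x
    using disc[of x] by (auto simp: u_def power_less_one_iff)
  have v: "3 / 4 \<le> v x" "v x \<le> 1" for x
    using power_mono[OF p_half[of x], of 2] by (auto simp: v_def power2_eq_square)
  have Q_nonneg: "Q x \<ge> 0" for x
    unfolding Q_def d_def using u[of x] v[of x] by auto
  define u' where "u' x = - 4 * \<eta> * (cmod (m x))\<^sup>2 + 2 * Im (q x * m x) * u x" for x
  define v' where "v' x = - 4 * \<eta> * (cmod (p x))\<^sup>2 + 2 * Im (q x * p x) * v x + 2 * Re (cnj (p x) * \<rho> x)" for x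
  define d' where "d' x = (4 * \<eta> + 2 * Im (q x * m x) + 2 * Im (q x * p x)) * d x
      + 2 * Re (cnj (m x - p x) * \<rho> x)" for x
  have du: "(u has_real_derivative u' x) (at x)" for x
    using DERIV_diff[OF DERIV_const[of 1] has_derivative_cmod_square[OF m[of x]]]
    unfolding u_def[abs_def] u'_def riccati_def defect_identity_exact \<eta>(2)
    by (elim DERIV_cong) (simp add: u_def algebra_simps)
  have dv: "(v has_real_derivative v' x) (at x)" for x
    using DERIV_diff[OF DERIV_const[of 1] has_derivative_cmod_square[OF p[of x]]]
    unfolding v_def[abs_def] v'_def riccati_def defect_identity \<eta>(2)
    by (elim DERIV_cong) (simp add: v_def algebra_simps)
  have dd: "(d has_real_derivative d' x) (at x)" for x
    using has_derivative_cmod_square[OF has_vector_derivative_diff[OF m[of x] p[of x]]]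
    unfolding d_def[abs_def] d'_def riccati_def difference_identity \<eta>(2) by (simp add: d_def)
  define Q' where "Q' x = (d' x * (u x * v x) - d x * (u' x * v x + u x * v' x)) / (u x * v x)\<^sup>2" for x
  have dQ: "(Q has_real_derivative Q' x) (at x)" for x
  proof -
    have "u x * v x \<noteq> 0" using u[of x] v[of x] by auto
    then show ?thesis
      unfolding Q_def[abs_def] Q'_def
      by (auto intro!: derivative_eq_intros du dv dd simp: power2_eq_square algebra_simps)
  qed
  have growth: "2 * \<eta> * Q x - 4 / 3 * \<epsilon>\<^sup>2 / \<eta> \<le> Q' x" for x
  proof -
    define r where "r = cmod (m x - p x)"
    have r: "d x = r\<^sup>2" "r \<ge> 0" by (simp_all add: d_def r_def)
    have pos: "u x > 0" "v x > 0" "u x * v x > 0" using u[of x] v[of x] by auto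
    \<comment> \<open>The terms with \<open>q\<close> have cancelled here.\<close>
    have Q'_eq: "Q' x = Q x * (4 * \<eta> / u x + 4 * \<eta> * (cmod (p x))\<^sup>2 / v x - 2 * Re (cnj (p x) * \<rho> x) / v x)
        + 2 * Re (cnj (m x - p x) * \<rho> x) / (u x * v x)"
    proof -
      have sq: "(cmod (m x))\<^sup>2 = 1 - u x" by (simp add: u_def)
      show ?thesis
        using pos unfolding Q'_def Q_def d'_def u'_def v'_def sq
        by (simp add: field_simps power2_eq_square)
    qed
    have a: "- (2 * Re (cnj (p x) * \<rho> x) / v x) \<ge> - \<eta>"
    proof -
      have "\<bar>Re (cnj (p x) * \<rho> x)\<bar> \<le> cmod (p x) * cmod (\<rho> x)"
        by (metis abs_Re_le_cmod norm_mult complex_mod_cnj)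
      also have "\<dots> \<le> 1 / 2 * \<epsilon>"
        using p_half[of x] \<rho>[of x] by (intro mult_mono) auto
      finally have "2 * Re (cnj (p x) * \<rho> x) \<le> \<epsilon>" by linarith
      also have "\<epsilon> \<le> \<eta> * (3 / 4)" using \<epsilon> \<eta> by simp
      also have "\<dots> \<le> \<eta> * v x" using v[of x] \<eta>(1) by (intro mult_left_mono) auto
      finally show ?thesis using pos by (simp add: field_simps)
    qed
    \<comment> \<open>Young's inequality with weight \<open>u x\<close>: the part \<open>\<eta> Q / u\<close> is
      absorbed by \<open>4 \<eta> Q / u\<close>, and the rest has no factor \<open>1 / u\<close>, which is not bounded
      uniformly in \<open>z\<close>.\<close>
    have b: "2 * Re (cnj (m x - p x) * \<rho> x) / (u x * v x) \<ge> - (\<eta> * Q x / u x) - 4 / 3 * \<epsilon>\<^sup>2 / \<eta>"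
    proof -
      have "\<bar>Re (cnj (m x - p x) * \<rho> x)\<bar> \<le> r * cmod (\<rho> x)"
        unfolding r_def by (metis abs_Re_le_cmod norm_mult complex_mod_cnj)
      also have "\<dots> \<le> r * \<epsilon>"
        using \<rho>[of x] r by (intro mult_left_mono) auto
      finally have "2 * Re (cnj (m x - p x) * \<rho> x) \<ge> - (2 * r * \<epsilon>)" by linarith
      moreover have "2 * r * \<epsilon> \<le> \<eta> * r\<^sup>2 / u x + \<epsilon>\<^sup>2 * u x / \<eta>"
      proof -
        have "0 \<le> (\<eta> * r - \<epsilon> * u x)\<^sup>2 / (\<eta> * u x)"
          using pos \<eta> by simp
        also have "\<dots> = \<eta> * r\<^sup>2 / u x + \<epsilon>\<^sup>2 * u x / \<eta> - 2 * r * \<epsilon>"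
          using pos \<eta> by (simp add: field_simps power2_eq_square)
        finally show ?thesis by simp
      qed
      ultimately have "2 * Re (cnj (m x - p x) * \<rho> x) / (u x * v x)
          \<ge> - ((\<eta> * r\<^sup>2 / u x + \<epsilon>\<^sup>2 * u x / \<eta>) / (u x * v x))"
        using pos unfolding minus_divide_left by (intro divide_right_mono) linarith+
      moreover have "(\<eta> * r\<^sup>2 / u x + \<epsilon>\<^sup>2 * u x / \<eta>) / (u x * v x) = \<eta> * Q x / u x + \<epsilon>\<^sup>2 / \<eta> * (1 / v x)"
        using pos \<eta> unfolding Q_def r(1) by (simp add: field_simps)
      moreover have "\<epsilon>\<^sup>2 / \<eta> * (1 / v x) \<le> \<epsilon>\<^sup>2 / \<eta> * (4 / 3)"
        using v[of x] \<eta> pos by (intro mult_left_mono) (auto simp: field_simps)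
      moreover have "\<epsilon>\<^sup>2 / \<eta> * (4 / 3) = 4 / 3 * \<epsilon>\<^sup>2 / \<eta>"
        by simp
      moreover have "- a \<le> b \<Longrightarrow> a = c + d \<Longrightarrow> d \<le> e \<Longrightarrow> e = f \<Longrightarrow> - c - f \<le> b" for a b c d e f :: real
        by linarith
      ultimately show ?thesis by blast
    qed
    have c: "2 * \<eta> * Q x \<le> Q x * (4 * \<eta> / u x - \<eta>) - \<eta> * Q x / u x"
    proof -
      have "\<eta> \<le> \<eta> / u x" using u[of x] \<eta> by (simp add: field_simps)
      then have "2 * \<eta> \<le> 4 * \<eta> / u x - \<eta> - \<eta> / u x"
        by simp
      then have "Q x * (2 * \<eta>) \<le> Q x * (4 * \<eta> / u x - \<eta> - \<eta> / u x)"
        using Q_nonneg by (intro mult_left_mono)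
      then show ?thesis by (simp add: algebra_simps)
    qed
    have "Q x * (4 * \<eta> / u x - \<eta>)
        \<le> Q x * (4 * \<eta> / u x + 4 * \<eta> * (cmod (p x))\<^sup>2 / v x - 2 * Re (cnj (p x) * \<rho> x) / v x)"
    proof (rule mult_left_mono[OF _ Q_nonneg])
      have "0 \<le> 4 * \<eta> * (cmod (p x))\<^sup>2 / v x" using pos \<eta> by simp
      then show "4 * \<eta> / u x - \<eta> \<le> 4 * \<eta> / u x + 4 * \<eta> * (cmod (p x))\<^sup>2 / v x - 2 * Re (cnj (p x) * \<rho> x) / v x"
        using a by linarith
    qed
    then show ?thesis
      unfolding Q'_eq using b c by linarith
  qed
  define u0 where "u0 = 4 * \<eta> / (4 * \<eta> + 2 * B)"
  have "u0 > 0" using \<eta> \<open>B \<ge> 0\<close> by (simp add: u0_def)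
  have bound: "Q x \<le> 4 / (u0 * (3 / 4))" for x
  proof -
    have "u0 \<le> u x"
      using disc_defect_lower_bound[OF m disc z q, of x] by (simp add: u0_def u_def \<eta>)
    then have "u0 * (3 / 4) \<le> u x * v x"
      using v[of x] u[of x] by (intro mult_mono) auto
    moreover have "cmod (m x - p x) \<le> 2"
      using norm_triangle_ineq4[of "m x" "p x"] disc[of x] p_half[of x] by linarith
    then have "d x \<le> 4"
      unfolding d_def using power_mono[of "cmod (m x - p x)" 2 2] by simp
    ultimately show ?thesis
      unfolding Q_def using \<open>u0 > 0\<close> by (intro frac_le) auto
  qed
  have "Q x \<le> (4 / 3 * \<epsilon>\<^sup>2 / \<eta>) / (2 * \<eta>)"
    by (rule bounded_above_growth[OF dQ growth _ bound]) (use \<eta> in simp)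
  also have "\<dots> = 2 / 3 * (\<epsilon> / \<eta>)\<^sup>2"
    by (simp add: power2_eq_square)
  also have "\<dots> \<le> (\<epsilon> / \<eta>)\<^sup>2"
    by simp
  finally have "Q x \<le> (\<epsilon> / \<eta>)\<^sup>2" .
  moreover have "d x \<le> Q x"
  proof -
    have uv: "u x * v x \<le> 1" "0 < u x * v x"
      using u[of x] v[of x] by (auto intro: mult_le_one)
    have "0 \<le> d x" by (simp add: d_def)
    from mult_left_mono[OF uv(1) this] show ?thesis
      unfolding Q_def pos_le_divide_eq[OF uv(2)] by (simp only: mult_1_right)
  qed
  ultimately have "(cmod (m x - p x))\<^sup>2 \<le> (\<epsilon> / \<eta>)\<^sup>2"
    by (simp add: d_def)
  then have "cmod (m x - p x) \<le> \<epsilon> / \<eta>"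
    by (rule power2_le_imp_le) (use \<open>\<epsilon> \<ge> 0\<close> \<eta>(1) in simp)
  then show ?thesis by (simp add: \<eta>_def)
qed

section \<open>An approximate solution of the Riccati equation\<close>

text \<open>
The mean of a Lipschitz function over \<open>[x, x + h]\<close> is differentiable in \<open>x\<close>.
\<close>

lemma smoothed_function:
  fixes c :: "real \<Rightarrow> complex"
  assumes L: "L \<ge> 0" "\<And>x y. cmod (c x - c y) \<le> L * \<bar>x - y\<bar>" and "h > 0"
  obtains w w' where "\<And>x. (w has_vector_derivative w' x) (at x)"
    "\<And>x. cmod (w x - c x) \<le> L * h" "\<And>x. cmod (w' x) \<le> L"
proof -
  have "continuous_on UNIV c"
    using L lipschitz_iff[of c] lipschitz_on_continuous_on by blast
  then obtain F where F: "\<And>x. (F has_vector_derivative c x) (at x)"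
    using antiderivative_exists by blast
  have shift: "((\<lambda>x. F (x + h)) has_vector_derivative c (x + h)) (at x)" for x
  proof -
    have "((\<lambda>x. x + h) has_vector_derivative 1 + 0) (at x)"
      by (intro has_vector_derivative_add has_vector_derivative_id has_vector_derivative_const)
    then show ?thesis
      using vector_diff_chain_at[of "\<lambda>x. x + h" 1 x F "c (x + h)"] F[of "x + h"] by (simp add: o_def)
  qed
  define w where "w x = (F (x + h) - F x) /\<^sub>R h" for x
  define w' where "w' x = (c (x + h) - c x) /\<^sub>R h" for x
  have "(w has_vector_derivative w' x) (at x)" for x
    unfolding w_def w'_def
    by (rule bounded_linear.has_vector_derivative[OF bounded_linear_scaleR_right
        has_vector_derivative_diff[OF shift F]])
  moreover have "cmod (w x - c x) \<le> L * h" for x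
  proof -
    have deriv: "((\<lambda>t. F t - t *\<^sub>R c x) has_vector_derivative c t - c x) (at t)" for t
      by (auto intro!: derivative_eq_intros F)
    have "cmod (F (x + h) - (x + h) *\<^sub>R c x - (F x - x *\<^sub>R c x)) \<le> (L * h) * (x + h - x)"
    proof (rule increment_bound[OF deriv])
      fix t assume "t \<in> {x..x + h}"
      then have "L * \<bar>t - x\<bar> \<le> L * h"
        using L(1) by (intro mult_left_mono) auto
      then show "cmod (c t - c x) \<le> L * h"
        using L(2)[of t x] by simp
    qed (use \<open>h > 0\<close> in simp)
    moreover have "w x - c x = (F (x + h) - (x + h) *\<^sub>R c x - (F x - x *\<^sub>R c x)) /\<^sub>R h"
      using \<open>h > 0\<close> by (simp add: w_def algebra_simps scaleR_conv_of_real)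
    ultimately have "cmod (w x - c x) \<le> inverse h * (L * h * h)"
      using \<open>h > 0\<close> by (simp add: mult_left_mono del: mult_le_cancel_left_pos)
    also have "inverse h * (L * h * h) = L * h"
      using \<open>h > 0\<close> by simp
    finally show ?thesis .
  qed
  moreover have "cmod (w' x) \<le> L" for x
  proof -
    have "cmod (w' x) = cmod (c (x + h) - c x) / h"
      using \<open>h > 0\<close> by (simp add: w'_def divide_inverse_commute)
    then show ?thesis
      using L(2)[of "x + h" x] \<open>h > 0\<close> by (simp add: pos_divide_le_eq)
  qed
  ultimately show thesis by (rule that)
qed

text \<open>
The square of the sum agrees with its Cauchy product up to order \<open>K\<close>; only pairs of indices with sum
greater than \<open>K\<close> are left over.
\<close>

lemma truncated_square:
  fixes a :: "nat \<Rightarrow> complex"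
  assumes "\<And>j. 1 \<le> j \<Longrightarrow> j \<le> K \<Longrightarrow> cmod (a j) \<le> M" and "M \<ge> 0" and "cmod y \<le> 1"
  shows "cmod ((\<Sum>j = 1..K. a j * y ^ j)\<^sup>2 - (\<Sum>j = 1..K. (\<Sum>l = 1..j - 1. a l * a (j - l)) * y ^ j))
    \<le> (real K * M)\<^sup>2 * cmod y ^ Suc K"
proof -
  define t where "t p = a (fst p) * a (snd p) * y ^ (fst p + snd p)" for p
  define S where "S = {1..K} \<times> {1..K}"
  have fin: "finite S" by (simp add: S_def)
  have square: "(\<Sum>j = 1..K. a j * y ^ j)\<^sup>2 = (\<Sum>p\<in>S. t p)"
    unfolding power2_eq_square sum_product S_def sum.cartesian_product
    by (rule sum.cong) (auto simp: t_def power_add)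
  have low: "(\<Sum>j = 1..K. (\<Sum>l = 1..j - 1. a l * a (j - l)) * y ^ j) = (\<Sum>p | p \<in> S \<and> fst p + snd p \<le> K. t p)"
    unfolding sum_distrib_right
    by (subst sum.Sigma, simp, simp)
       (rule sum.reindex_bij_witness[where i = "\<lambda>p. (fst p + snd p, fst p)" and j = "\<lambda>p. (snd p, fst p - snd p)"],
        auto simp: t_def S_def)
  have split: "S = {p. p \<in> S \<and> fst p + snd p \<le> K} \<union> {p. p \<in> S \<and> K < fst p + snd p}"
    by auto
  have "(\<Sum>p\<in>S. t p) = (\<Sum>p | p \<in> S \<and> fst p + snd p \<le> K. t p) + (\<Sum>p | p \<in> S \<and> K < fst p + snd p. t p)"
    by (subst split, rule sum.union_disjoint) (use fin in auto)
  then have "(\<Sum>j = 1..K. a j * y ^ j)\<^sup>2 - (\<Sum>j = 1..K. (\<Sum>l = 1..j - 1. a l * a (j - l)) * y ^ j)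
      = (\<Sum>p | p \<in> S \<and> K < fst p + snd p. t p)"
    by (simp only: square low) simp
  also have "cmod \<dots> \<le> (\<Sum>p | p \<in> S \<and> K < fst p + snd p. M * M * cmod y ^ Suc K)"
  proof (rule sum_norm_le)
    fix p assume "p \<in> {p. p \<in> S \<and> K < fst p + snd p}"
    then have p: "cmod (a (fst p)) \<le> M" "cmod (a (snd p)) \<le> M" "Suc K \<le> fst p + snd p"
      using assms(1) by (auto simp: S_def)
    then show "cmod (t p) \<le> M * M * cmod y ^ Suc K"
      unfolding t_def norm_mult norm_power using assms(2,3)
      by (intro mult_mono power_decreasing) auto
  qed
  also have "\<dots> \<le> (\<Sum>p\<in>S. M * M * cmod y ^ Suc K)"
    using fin assms(2) by (intro sum_mono2) auto
  also have "\<dots> = (real K * M)\<^sup>2 * cmod y ^ Suc K"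
    by (simp add: S_def power2_eq_square)
  finally show ?thesis .
qed

text \<open>
Here \<open>y\<close> stands for \<open>1 / z\<close>, and \<open>a\<close>, \<open>a'\<close> for the values of the coefficients and their derivatives
at one point. The recursion cancels all orders below \<open>K\<close>. The remaining term of order \<open>K\<close> is the one that
the next coefficient would cancel.
\<close>

lemma formal_solution_residual:
  fixes a a' :: "nat \<Rightarrow> complex"
  assumes a1: "a 1 = cnj Q / 2"
    and step: "\<And>j. 1 \<le> j \<Longrightarrow> j \<le> K \<Longrightarrow>
      a (Suc j) = - (\<i> / 2) * a' j + Q / 2 * (\<Sum>l = 1..j - 1. a l * a (j - l))"
    and yz: "y * z = 1" and s: "s = (\<Sum>j = 1..K. a j * y ^ j)"
  shows "2 * \<i> * z * s - \<i> * (cnj Q + Q * s\<^sup>2) - (\<Sum>j = 1..K. a' j * y ^ j)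
    = - 2 * \<i> * a (Suc K) * y ^ K
      - \<i> * Q * (s\<^sup>2 - (\<Sum>j = 1..K. (\<Sum>l = 1..j - 1. a l * a (j - l)) * y ^ j))"
proof -
  have "z * s = (\<Sum>j = 1..K. a j * y ^ (j - 1))"
    unfolding s sum_distrib_left
  proof (rule sum.cong)
    fix j assume "j \<in> {1..K}"
    then obtain i where "j = Suc i" by (auto simp: Suc_le_D elim: Suc_le_D[THEN exE])
    then show "z * (a j * y ^ j) = a j * y ^ (j - 1)"
      using yz by (simp add: algebra_simps)
  qed simp
  also have "\<dots> = (\<Sum>i<K. a (Suc i) * y ^ i)"
    by (simp add: sum.atLeast1_atMost_eq)
  also have "\<dots> = (\<Sum>i<Suc K. a (Suc i) * y ^ i) - a (Suc K) * y ^ K"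
    by simp
  also have "(\<Sum>i<Suc K. a (Suc i) * y ^ i) = a 1 + (\<Sum>j = 1..K. a (Suc j) * y ^ j)"
    by (subst sum.lessThan_Suc_shift) (simp add: sum.atLeast1_atMost_eq)
  finally have zs: "z * s = a 1 + (\<Sum>j = 1..K. a (Suc j) * y ^ j) - a (Suc K) * y ^ K" .
  have "2 * \<i> * (\<Sum>j = 1..K. a (Suc j) * y ^ j)
      = (\<Sum>j = 1..K. a' j * y ^ j + \<i> * Q * ((\<Sum>l = 1..j - 1. a l * a (j - l)) * y ^ j))"
    unfolding sum_distrib_left[of "2 * \<i>"]
  proof (rule sum.cong)
    fix j assume "j \<in> {1..K}"
    then have j: "a (Suc j) = - (\<i> / 2) * a' j + Q / 2 * (\<Sum>l = 1..j - 1. a l * a (j - l))"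
      using step by simp
    have "2 * \<i> * (- (\<i> / 2) * A + Q / 2 * B) * Y = A * Y + \<i> * Q * (B * Y)" for A B Y
      by (simp add: algebra_simps)
    then show "2 * \<i> * (a (Suc j) * y ^ j) = a' j * y ^ j + \<i> * Q * ((\<Sum>l = 1..j - 1. a l * a (j - l)) * y ^ j)"
      unfolding j by (simp only: mult.assoc)
  qed simp
  also have "\<dots> = (\<Sum>j = 1..K. a' j * y ^ j) + \<i> * Q * (\<Sum>j = 1..K. (\<Sum>l = 1..j - 1. a l * a (j - l)) * y ^ j)"
    by (simp only: sum.distrib sum_distrib_left)
  finally have sum: "2 * \<i> * (\<Sum>j = 1..K. a (Suc j) * y ^ j)
      = (\<Sum>j = 1..K. a' j * y ^ j) + \<i> * Q * (\<Sum>j = 1..K. (\<Sum>l = 1..j - 1. a l * a (j - l)) * y ^ j)" .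
  have "2 * \<i> * z * s = \<i> * cnj Q + 2 * \<i> * (\<Sum>j = 1..K. a (Suc j) * y ^ j) - 2 * \<i> * (a (Suc K) * y ^ K)"
    unfolding mult.assoc[of _ z s] zs a1 by (simp add: algebra_simps)
  then show ?thesis
    unfolding sum by (simp add: algebra_simps)
qed

lemma riccati_perturbation:
  fixes s t z Q :: complex
  shows "2 * \<i> * z * (s + t) - \<i> * (cnj Q + Q * (s + t)\<^sup>2)
    = (2 * \<i> * z * s - \<i> * (cnj Q + Q * s\<^sup>2)) + 2 * \<i> * (z * t) - \<i> * Q * (2 * s + t) * t"
  by (simp add: algebra_simps power2_eq_square)

lemma polynomial_bound:
  fixes a :: "nat \<Rightarrow> complex"
  assumes "\<And>j. j \<in> {m..K} \<Longrightarrow> cmod (a j) \<le> M" and "M \<ge> 0" and "cmod y \<le> 1" and "m \<ge> 1"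
  shows "cmod (\<Sum>j = m..K. a j * y ^ j) \<le> real K * M * cmod y ^ m"
proof -
  have "cmod (\<Sum>j = m..K. a j * y ^ j) \<le> (\<Sum>j = m..K. M * cmod y ^ m)"
  proof (rule sum_norm_le)
    fix j assume "j \<in> {m..K}"
    then show "cmod (a j * y ^ j) \<le> M * cmod y ^ m"
      unfolding norm_mult norm_power using assms by (intro mult_mono power_decreasing) auto
  qed
  also have "\<dots> = real (card {m..K}) * (M * cmod y ^ m)" by simp
  also have "\<dots> \<le> real K * (M * cmod y ^ m)"
    using assms(2,4) by (intro mult_right_mono) auto
  finally show ?thesis by simp
qed

text \<open>
The truncated formal solution. Its last coefficient, the one of order \<open>K + 1\<close>, is only Lipschitz and is
averaged over a length \<open>\<bar>z\<bar>\<^sup>-\<^sup>1\<close>: the averaging error \<open>O(\<bar>z\<bar>\<^sup>-\<^sup>1)\<close> enters the residual at order \<open>K\<close>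
and the derivative of the average, which is bounded, at order \<open>K + 1\<close>, so that both have the size of the
residual aimed at.
\<close>

lemma riccati_approximate_solution:
  assumes q: "bounded_lipschitz_deriv K q"
  obtains C where "C > 0" and "\<And>z. cmod z \<ge> 1 \<Longrightarrow> \<exists>p \<rho>.
      (\<forall>x. (p has_vector_derivative riccati q z p x - \<rho> x) (at x)) \<and>
      (\<forall>x. cmod (\<rho> x) \<le> C * cmod (inverse z) ^ Suc K) \<and>
      (\<forall>x. cmod (p x) \<le> C * cmod (inverse z)) \<and>
      (\<forall>n\<le>K. cmod (p 0 - (\<Sum>j = 1..K - n. dirac_coeff q j 0 * inverse z ^ j))
          \<le> C * cmod (inverse z) ^ (Suc K - n))"
proof -
  define c where "c = dirac_coeff q"
  define c' where "c' j x = vector_derivative (c j) (at x)" for j x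
  have reg: "bounded_lipschitz_deriv (Suc K - j) (c j)" if "1 \<le> j" "j \<le> Suc K" for j
    unfolding c_def using dirac_coeff_regular[OF q that] .
  have c': "(c j has_vector_derivative c' j x) (at x)" if "1 \<le> j" "j \<le> K" for j x
  proof -
    have "Suc K - j = Suc (K - j)" using that by simp
    then show ?thesis
      unfolding c'_def using bounded_lipschitz_deriv_derivative(1)[of "K - j" "c j"] reg[of j] that by simp
  qed
  have "\<forall>j\<in>{1..Suc K}. \<exists>M\<ge>0. \<forall>x. cmod (c j x) \<le> M"
    using reg bounded_lipschitz_deriv_bounded bounded_range_iff by (metis atLeastAtMost_iff)
  then obtain Mj where Mj: "\<And>j. j \<in> {1..Suc K} \<Longrightarrow> Mj j \<ge> 0 \<and> (\<forall>x. cmod (c j x) \<le> Mj j)"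
    by metis
  define M where "M = (\<Sum>j = 1..Suc K. Mj j)"
  have M: "cmod (c j x) \<le> M" if "1 \<le> j" "j \<le> Suc K" for j x
  proof -
    have "Mj j \<le> M"
      unfolding M_def using Mj that by (intro member_le_sum) auto
    then show ?thesis using Mj[of j] that order_trans by auto
  qed
  have "M \<ge> 0" unfolding M_def using Mj by (intro sum_nonneg) auto
  obtain B where B: "B \<ge> 0" "\<And>x. cmod (q x) \<le> B"
    using bounded_lipschitz_deriv_bounded[OF q] unfolding bounded_range_iff by blast
  have "bounded_lipschitz_deriv 0 (c (Suc K))"
    using reg[of "Suc K"] by simp
  then obtain L where L: "L \<ge> 0" "\<And>x y. cmod (c (Suc K) x - c (Suc K) y) \<le> L * \<bar>x - y\<bar>"
    by (auto simp: lipschitz_iff)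
  define W where "W = M + L"
  have "W \<ge> 0" using \<open>M \<ge> 0\<close> L by (simp add: W_def)
  define C where "C = 2 * L + B * (real K * M)\<^sup>2 + B * (2 * (real K * M) + W) * W + L + (real K * M + W) + 1"
  have parts_nonneg: "0 \<le> B * (real K * M)\<^sup>2" "0 \<le> B * (2 * (real K * M) + W) * W" "0 \<le> real K * M"
    using B(1) \<open>M \<ge> 0\<close> \<open>W \<ge> 0\<close> by auto
  show thesis
  proof (rule that)
    show "C > 0"
      unfolding C_def using parts_nonneg L(1) \<open>W \<ge> 0\<close> by linarith
    fix z :: complex assume z: "cmod z \<ge> 1"
    define y where "y = inverse z"
    define h where "h = cmod y"
    have "z \<noteq> 0" using z by auto
    then have yz: "y * z = 1" by (simp add: y_def)
    have h: "h > 0" "h \<le> 1"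
      using z \<open>z \<noteq> 0\<close> by (simp_all add: h_def y_def norm_inverse inverse_le_1_iff)
    have hpow: "h ^ i \<le> h ^ j" if "j \<le> i" for i j
      using power_decreasing[OF that, of h] h by simp
    obtain w w' where w: "\<And>x. (w has_vector_derivative w' x) (at x)"
      "\<And>x. cmod (w x - c (Suc K) x) \<le> L * h" "\<And>x. cmod (w' x) \<le> L"
      using smoothed_function[OF L h(1)] by blast
    have wW: "cmod (w x) \<le> W" for x
    proof -
      have "cmod (w x) \<le> cmod (c (Suc K) x) + cmod (w x - c (Suc K) x)"
        by (rule norm_triangle_sub)
      also have "\<dots> \<le> M + L * 1"
        using M[of "Suc K" x] w(2)[of x] mult_left_mono[OF h(2) L(1)] by (intro add_mono) auto
      finally show ?thesis by (simp add: W_def)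
    qed
    define s where "s x = (\<Sum>j = 1..K. c j x * y ^ j)" for x
    define s' where "s' x = (\<Sum>j = 1..K. c' j x * y ^ j)" for x
    define p where "p x = s x + w x * y ^ Suc K" for x
    define p' where "p' x = s' x + w' x * y ^ Suc K" for x
    have p': "(p has_vector_derivative p' x) (at x)" for x
      unfolding p_def p'_def s_def s'_def
      by (intro has_vector_derivative_add has_vector_derivative_sum has_vector_derivative_mult_left c' w) auto
    define \<rho> where "\<rho> x = riccati q z p x - p' x" for x
    have s_bound: "cmod (s x) \<le> real K * M * h" for x
      using polynomial_bound[of 1 K "\<lambda>j. c j x" M y] M \<open>M \<ge> 0\<close> h by (simp add: s_def h_def)
    have t_bound: "cmod (w x * y ^ Suc K) \<le> W * h ^ Suc K" for x
      unfolding norm_mult norm_power h_def using wW by (intro mult_right_mono) auto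
    have \<rho>_bound: "cmod (\<rho> x) \<le> C * h ^ Suc K" for x
    proof -
      define T where "T = (s x)\<^sup>2 - (\<Sum>j = 1..K. (\<Sum>l = 1..j - 1. c l x * c (j - l) x) * y ^ j)"
      have "2 * \<i> * z * s x - \<i> * (cnj (q x) + q x * (s x)\<^sup>2) - s' x
          = - 2 * \<i> * c (Suc K) x * y ^ K - \<i> * q x * T"
        unfolding T_def s'_def
      proof (rule formal_solution_residual[OF _ _ yz])
        fix j assume "1 \<le> j" "j \<le> K"
        then obtain i where "j = Suc i" by (cases j) auto
        then show "c (Suc j) x = - (\<i> / 2) * c' j x + q x / 2 * (\<Sum>l = 1..j - 1. c l x * c (j - l) x)"
          by (simp add: c_def c'_def)
      qed (simp_all add: c_def s_def)
      note residual = this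
      have zt: "z * (w x * y ^ Suc K) = w x * y ^ K"
        using yz by (simp add: algebra_simps)
      have "\<rho> x = (2 * \<i> * z * s x - \<i> * (cnj (q x) + q x * (s x)\<^sup>2) - s' x)
          + 2 * \<i> * (z * (w x * y ^ Suc K))
          - \<i> * q x * (2 * s x + w x * y ^ Suc K) * (w x * y ^ Suc K) - w' x * y ^ Suc K"
        unfolding \<rho>_def riccati_def p_def p'_def riccati_perturbation by simp
      then have \<rho>_eq: "\<rho> x = 2 * \<i> * (w x - c (Suc K) x) * y ^ K + (- (\<i> * q x * T))
          + (- (\<i> * q x * (2 * s x + w x * y ^ Suc K) * (w x * y ^ Suc K))) + (- (w' x * y ^ Suc K))"
        unfolding residual zt by (simp add: algebra_simps)
      have 1: "cmod (2 * \<i> * (w x - c (Suc K) x) * y ^ K) \<le> 2 * L * h ^ Suc K"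
      proof -
        have "cmod (2 * \<i> * (w x - c (Suc K) x) * y ^ K) = 2 * (cmod (w x - c (Suc K) x) * h ^ K)"
          by (simp only: norm_mult norm_power h_def) simp
        also have "\<dots> \<le> 2 * (L * h * h ^ K)"
          using mult_right_mono[OF w(2)[of x], of "h ^ K"] h by simp
        finally show ?thesis by simp
      qed
      have "cmod T \<le> (real K * M)\<^sup>2 * h ^ Suc K"
        unfolding T_def s_def h_def
        by (rule truncated_square) (use M \<open>M \<ge> 0\<close> h in \<open>auto simp: h_def\<close>)
      then have 2: "cmod (- (\<i> * q x * T)) \<le> B * ((real K * M)\<^sup>2 * h ^ Suc K)"
        using B by (simp add: norm_mult mult_mono)
      have "cmod (2 * s x + w x * y ^ Suc K) \<le> 2 * (real K * M) + W"
      proof -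
        have "cmod (2 * s x) \<le> 2 * (real K * M)"
          using s_bound[of x] mult_left_mono[OF h(2) parts_nonneg(3)] by (simp add: norm_mult)
        moreover have "cmod (w x * y ^ Suc K) \<le> W"
          using t_bound[of x] mult_left_mono[OF power_le_one[of h "Suc K"] \<open>W \<ge> 0\<close>] h by simp
        ultimately show ?thesis by (rule norm_triangle_mono)
      qed
      then have 3: "cmod (- (\<i> * q x * (2 * s x + w x * y ^ Suc K) * (w x * y ^ Suc K)))
          \<le> B * (2 * (real K * M) + W) * (W * h ^ Suc K)"
        unfolding norm_minus_cancel norm_mult[of "_ * (2 * s x + w x * y ^ Suc K)"]
          norm_mult[of _ "2 * s x + w x * y ^ Suc K"]
        using B t_bound[of x] parts_nonneg \<open>W \<ge> 0\<close> h
        by (intro mult_mono) (auto simp: norm_mult)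
      have 4: "cmod (- (w' x * y ^ Suc K)) \<le> L * h ^ Suc K"
        unfolding norm_minus_cancel norm_mult norm_power h_def using w(3) by (intro mult_right_mono) auto
      have "cmod (\<rho> x) \<le> 2 * L * h ^ Suc K + B * ((real K * M)\<^sup>2 * h ^ Suc K)
          + B * (2 * (real K * M) + W) * (W * h ^ Suc K) + L * h ^ Suc K"
        unfolding \<rho>_eq by (intro norm_triangle_mono 1 2 3 4)
      also have "\<dots> = (2 * L + B * (real K * M)\<^sup>2 + B * (2 * (real K * M) + W) * W + L) * h ^ Suc K"
        by (simp add: algebra_simps)
      also have "\<dots> \<le> C * h ^ Suc K"
        unfolding C_def using parts_nonneg L(1) \<open>W \<ge> 0\<close> h by (intro mult_right_mono) auto
      finally show ?thesis .
    qed
    have C_ge: "real K * M + W \<le> C"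
      unfolding C_def using parts_nonneg L(1) \<open>W \<ge> 0\<close> by linarith
    have p_bound: "cmod (p x) \<le> C * h" for x
    proof -
      have "W * h ^ Suc K \<le> W * h"
        using hpow[of 1 "Suc K"] \<open>W \<ge> 0\<close> by (intro mult_left_mono) auto
      then have "cmod (p x) \<le> real K * M * h + W * h"
        unfolding p_def using s_bound[of x] t_bound[of x] by (intro norm_triangle_mono) auto
      also have "\<dots> \<le> C * h"
        using mult_right_mono[OF C_ge, of h] h by (simp add: algebra_simps)
      finally show ?thesis .
    qed
    have tail: "cmod (p 0 - (\<Sum>j = 1..K - n. c j 0 * y ^ j)) \<le> C * h ^ (Suc K - n)" if "n \<le> K" for n
    proof -
      have "{1..K} = {1..K - n} \<union> {Suc K - n..K}" "{1..K - n} \<inter> {Suc K - n..K} = {}"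
        using that by auto
      then have "s 0 = (\<Sum>j = 1..K - n. c j 0 * y ^ j) + (\<Sum>j = Suc K - n..K. c j 0 * y ^ j)"
        unfolding s_def by (simp add: sum.union_disjoint)
      then have "p 0 - (\<Sum>j = 1..K - n. c j 0 * y ^ j) = (\<Sum>j = Suc K - n..K. c j 0 * y ^ j) + w 0 * y ^ Suc K"
        by (simp add: p_def)
      also have "cmod \<dots> \<le> real K * M * h ^ (Suc K - n) + W * h ^ (Suc K - n)"
      proof (rule norm_triangle_mono)
        show "cmod (\<Sum>j = Suc K - n..K. c j 0 * y ^ j) \<le> real K * M * h ^ (Suc K - n)"
          unfolding h_def using M \<open>M \<ge> 0\<close> h that by (intro polynomial_bound) (auto simp: h_def)
        have "W * h ^ Suc K \<le> W * h ^ (Suc K - n)"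
          using hpow[of "Suc K - n" "Suc K"] \<open>W \<ge> 0\<close> by (intro mult_left_mono) auto
        then show "cmod (w 0 * y ^ Suc K) \<le> W * h ^ (Suc K - n)"
          using t_bound[of 0] by linarith
      qed
      also have "\<dots> \<le> C * h ^ (Suc K - n)"
        using mult_right_mono[OF C_ge, of "h ^ (Suc K - n)"] h by (simp add: algebra_simps)
      finally show ?thesis .
    qed
    have "(p has_vector_derivative riccati q z p x - \<rho> x) (at x)" for x
      using p'[of x] by (simp add: \<rho>_def)
    then show "\<exists>p \<rho>.
      (\<forall>x. (p has_vector_derivative riccati q z p x - \<rho> x) (at x)) \<and>
      (\<forall>x. cmod (\<rho> x) \<le> C * cmod (inverse z) ^ Suc K) \<and>
      (\<forall>x. cmod (p x) \<le> C * cmod (inverse z)) \<and>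
      (\<forall>n\<le>K. cmod (p 0 - (\<Sum>j = 1..K - n. dirac_coeff q j 0 * inverse z ^ j))
          \<le> C * cmod (inverse z) ^ (Suc K - n))"
      using \<rho>_bound p_bound tail unfolding h_def y_def c_def by blast
  qed
qed

section \<open>Weyl solutions and the expansion\<close>

lemma dirac_eq_iff:
  "dirac q f x = z *s f x \<longleftrightarrow>
    \<i> * vector_derivative f (at x) $ 1 + q x * f x $ 2 = z * f x $ 1 \<and>
    - (\<i> * vector_derivative f (at x) $ 2) + cnj (q x) * f x $ 1 = z * f x $ 2"
  unfolding dirac_def vec_eq_iff forall_2
  by (simp add: matrix_vector_mult_def sum_2)

lemma dirac_solution_components:
  assumes "dirac_solution q z f"
  shows "((\<lambda>x. f x $ 1) has_vector_derivative - \<i> * z * f x $ 1 + \<i> * q x * f x $ 2) (at x)"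
    and "((\<lambda>x. f x $ 2) has_vector_derivative \<i> * z * f x $ 2 - \<i> * cnj (q x) * f x $ 1) (at x)"
proof -
  define d where "d = vector_derivative f (at x)"
  have "(f has_vector_derivative d) (at x)"
    using assms by (simp add: dirac_solution_def d_def vector_derivative_works)
  then have component: "((\<lambda>x. f x $ i) has_vector_derivative d $ i) (at x)" for i
    by (rule bounded_linear.has_vector_derivative[OF bounded_linear_vec_nth])
  have eq: "\<i> * d $ 1 + q x * f x $ 2 = z * f x $ 1" "- (\<i> * d $ 2) + cnj (q x) * f x $ 1 = z * f x $ 2"
    using assms by (simp_all add: dirac_solution_def dirac_eq_iff d_def)
  have "d $ 1 = - \<i> * (z * f x $ 1 - q x * f x $ 2)"
    unfolding eq(1)[symmetric] by (simp add: algebra_simps)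
  with component[of 1] show "((\<lambda>x. f x $ 1) has_vector_derivative - \<i> * z * f x $ 1 + \<i> * q x * f x $ 2) (at x)"
    by (simp add: algebra_simps)
  have "d $ 2 = \<i> * (z * f x $ 2 - cnj (q x) * f x $ 1)"
    unfolding eq(2)[symmetric] by (simp add: algebra_simps)
  with component[of 2] show "((\<lambda>x. f x $ 2) has_vector_derivative \<i> * z * f x $ 2 - \<i> * cnj (q x) * f x $ 1) (at x)"
    by (simp add: algebra_simps)
qed

lemma norm_square_components:
  fixes v :: "complex ^ 2"
  shows "(norm v)\<^sup>2 = (cmod (v $ 1))\<^sup>2 + (cmod (v $ 2))\<^sup>2"
  by (simp add: norm_vec_def L2_set_def sum_2)

lemma dirac_solution_energy:
  assumes "dirac_solution q z f"
  shows "((\<lambda>x. (cmod (f x $ 1))\<^sup>2 - (cmod (f x $ 2))\<^sup>2) has_real_derivative 2 * Im z * (norm (f x))\<^sup>2) (at x)"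
proof -
  have "2 * Re (cnj a * (- \<i> * z * a + \<i> * Q * b)) - 2 * Re (cnj b * (\<i> * z * b - \<i> * cnj Q * a))
      = 2 * Im z * ((cmod a)\<^sup>2 + (cmod b)\<^sup>2)" for a b Q
    unfolding cmod_power2 by (simp add: power2_eq_square algebra_simps)
  then show ?thesis
    using DERIV_diff[OF dirac_solution_components(1)[OF assms, THEN has_derivative_cmod_square, of x]
        dirac_solution_components(2)[OF assms, THEN has_derivative_cmod_square, of x]]
    unfolding norm_square_components by simp
qed

text \<open>
Uniqueness for the initial value problem, by Gronwall's inequality for \<open>\<bar>f\<bar>\<^sup>2\<close> in both directions.
\<close>

lemma dirac_solution_zero:
  assumes sol: "dirac_solution q z f" and q: "\<And>x. cmod (q x) \<le> B" and zero: "f x0 = 0"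
  shows "f x = 0"
proof -
  define S where "S x = (norm (f x))\<^sup>2" for x
  define S' where "S' x = 2 * Im z * ((cmod (f x $ 1))\<^sup>2 - (cmod (f x $ 2))\<^sup>2)
      + 4 * Re (\<i> * q x * f x $ 2 * cnj (f x $ 1))" for x
  define k where "k = 2 * cmod z + 2 * B"
  have "2 * Re (cnj a * (- \<i> * z * a + \<i> * Q * b)) + 2 * Re (cnj b * (\<i> * z * b - \<i> * cnj Q * a))
      = 2 * Im z * ((cmod a)\<^sup>2 - (cmod b)\<^sup>2) + 4 * Re (\<i> * Q * b * cnj a)" for a b Q
    unfolding cmod_power2 by (simp add: power2_eq_square algebra_simps)
  then have S: "(S has_real_derivative S' y) (at y)" for y
    using DERIV_add[OF dirac_solution_components(1)[OF sol, THEN has_derivative_cmod_square, of y]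
        dirac_solution_components(2)[OF sol, THEN has_derivative_cmod_square, of y]]
    unfolding S_def[abs_def] norm_square_components S'_def by simp
  have S'_bound: "\<bar>S' y\<bar> \<le> k * S y" for y
  proof -
    have S_eq: "S y = (cmod (f y $ 1))\<^sup>2 + (cmod (f y $ 2))\<^sup>2"
      by (simp add: S_def norm_square_components)
    have "\<bar>Im z * ((cmod (f y $ 1))\<^sup>2 - (cmod (f y $ 2))\<^sup>2)\<bar> \<le> cmod z * S y"
      unfolding abs_mult S_eq
      by (intro mult_mono abs_Im_le_cmod order_trans[OF abs_triangle_ineq4]) auto
    moreover have "\<bar>Re (\<i> * q y * f y $ 2 * cnj (f y $ 1))\<bar> \<le> B * (cmod (f y $ 2) * cmod (f y $ 1))"
    proof -
      have "\<bar>Re (\<i> * q y * f y $ 2 * cnj (f y $ 1))\<bar> \<le> cmod (\<i> * q y * f y $ 2 * cnj (f y $ 1))"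
        by (rule abs_Re_le_cmod)
      also have "\<dots> = cmod (q y) * (cmod (f y $ 2) * cmod (f y $ 1))"
        by (simp add: norm_mult)
      also have "\<dots> \<le> B * (cmod (f y $ 2) * cmod (f y $ 1))"
        using q by (intro mult_right_mono) auto
      finally show ?thesis .
    qed
    moreover have "B * (2 * (cmod (f y $ 2) * cmod (f y $ 1))) \<le> B * S y"
    proof (rule mult_left_mono)
      show "2 * (cmod (f y $ 2) * cmod (f y $ 1)) \<le> S y"
        using sum_squares_bound[of "cmod (f y $ 2)" "cmod (f y $ 1)"] by (simp add: S_eq)
      show "B \<ge> 0" using q[of 0] norm_ge_zero order_trans by blast
    qed
    ultimately show ?thesis
      unfolding S'_def k_def distrib_right by linarith
  qed
  have S_nonneg: "S y \<ge> 0" for y by (simp add: S_def)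
  have "S x0 = 0" using zero by (simp add: S_def)
  have "S x \<le> 0"
  proof (cases "x0 \<le> x")
    case True
    have "S x * exp (- k * x) \<le> S x0 * exp (- k * x0)"
    proof (rule DERIV_nonpos_imp_nonincreasing[OF True])
      fix y
      have "((\<lambda>y. S y * exp (- k * y)) has_real_derivative (S' y - k * S y) * exp (- k * y)) (at y)"
        by (auto intro!: derivative_eq_intros S simp: algebra_simps)
      moreover have "(S' y - k * S y) * exp (- k * y) \<le> 0"
        using S'_bound[of y] by (intro mult_nonpos_nonneg) auto
      ultimately show "\<exists>d. ((\<lambda>y. S y * exp (- k * y)) has_real_derivative d) (at y) \<and> d \<le> 0"
        by blast
    qed
    then show ?thesis using \<open>S x0 = 0\<close> by (simp add: mult_le_0_iff)
  next
    case False
    then have "x \<le> x0" by simp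
    have "S x * exp (k * x) \<le> S x0 * exp (k * x0)"
    proof (rule DERIV_nonneg_imp_nondecreasing[OF \<open>x \<le> x0\<close>])
      fix y
      have "((\<lambda>y. S y * exp (k * y)) has_real_derivative (S' y + k * S y) * exp (k * y)) (at y)"
        by (auto intro!: derivative_eq_intros S simp: algebra_simps)
      moreover have "(S' y + k * S y) * exp (k * y) \<ge> 0"
        using S'_bound[of y] by (intro mult_nonneg_nonneg) auto
      ultimately show "\<exists>d. ((\<lambda>y. S y * exp (k * y)) has_real_derivative d) (at y) \<and> 0 \<le> d"
        by blast
    qed
    then show ?thesis using \<open>S x0 = 0\<close> by (simp add: mult_le_0_iff)
  qed
  then show ?thesis by (simp add: S_def)
qed

lemma not_set_integrable_bounded_below:
  fixes g :: "real \<Rightarrow> real"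
  assumes "\<And>x. b \<le> x \<Longrightarrow> \<delta> \<le> g x" and "\<delta> > 0"
  shows "\<not> set_integrable lborel {a..} g"
proof
  assume int: "set_integrable lborel {a..} g"
  define I where "I = (LINT x:{a..}|lborel. \<bar>g x\<bar>)"
  define l where "l = max a b"
  have int': "integrable lborel (\<lambda>x. indicator {a..} x *\<^sub>R \<bar>g x\<bar>)"
    using set_integrable_abs[OF int] by (simp add: set_integrable_def)
  have "\<delta> * r \<le> I" if "r \<ge> 0" for r
  proof -
    have "\<delta> * r = (LINT x|lborel. indicator {l..l + r} x * \<delta>)"
      using that by simp
    also have "\<dots> \<le> (LINT x|lborel. indicator {a..} x *\<^sub>R \<bar>g x\<bar>)"
    proof (rule integral_mono[OF _ int'])
      show "integrable lborel (\<lambda>x. indicator {l..l + r} x * \<delta>)"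
        by (intro integrable_mult_left integrable_real_indicator) (auto simp: emeasure_lborel_Icc_eq)
      fix x
      show "indicator {l..l + r} x * \<delta> \<le> indicator {a..} x *\<^sub>R \<bar>g x\<bar>"
        using assms(1)[of x] by (auto simp: indicator_def l_def)
    qed
    finally show ?thesis by (simp add: I_def set_lebesgue_integral_def)
  qed
  from this[of "(\<bar>I\<bar> + 1) / \<delta>"] show False
    using \<open>\<delta> > 0\<close> by simp
qed

text \<open>
\<open>E = \<bar>f\<^sub>1\<bar>\<^sup>2 - \<bar>f\<^sub>2\<bar>\<^sup>2\<close> decreases strictly. Once negative it would stay below a negative number, and
\<open>\<bar>f\<bar>\<^sup>2 \<ge> - E\<close> would not be integrable at \<open>+\<infinity>\<close>.
\<close>

lemma weyl_solution_plus_disc: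
  assumes weyl: "weyl_solution_plus q z f" and z: "Im z < 0" and q: "\<And>x. cmod (q x) \<le> B"
  shows "cmod (f x $ 2) < cmod (f x $ 1)"
proof -
  have sol: "dirac_solution q z f"
    using weyl by (simp add: weyl_solution_plus_def)
  obtain x1 where "f x1 \<noteq> 0"
    using weyl by (auto simp: weyl_solution_plus_def)
  then have nonzero: "f x \<noteq> 0" for x
    using dirac_solution_zero[OF sol q] by blast
  define E where "E x = (cmod (f x $ 1))\<^sup>2 - (cmod (f x $ 2))\<^sup>2" for x
  have dE: "(E has_real_derivative 2 * Im z * (norm (f x))\<^sup>2) (at x)" for x
    unfolding E_def[abs_def] by (rule dirac_solution_energy[OF sol])
  have decreasing: "E y < E x" if "x < y" for x y
  proof (rule DERIV_neg_imp_decreasing[OF that])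
    fix t
    have "2 * Im z * (norm (f t))\<^sup>2 < 0"
      using z nonzero[of t] by (simp add: mult_less_0_iff)
    with dE[of t] show "\<exists>d. (E has_real_derivative d) (at t) \<and> d < 0"
      by blast
  qed
  have nonneg: "E x \<ge> 0" for x
  proof (rule ccontr)
    assume "\<not> E x \<ge> 0"
    have "- E x \<le> (norm (f y))\<^sup>2" if "x \<le> y" for y
    proof -
      have "- E x \<le> - E y"
        using decreasing[of x y] that by (cases "x = y") auto
      also have "\<dots> \<le> (norm (f y))\<^sup>2"
        by (simp add: E_def norm_square_components)
      finally show ?thesis .
    qed
    then have "\<not> set_integrable lborel {a..} (\<lambda>x. (norm (f x))\<^sup>2)" for a
      using \<open>\<not> E x \<ge> 0\<close> by (intro not_set_integrable_bounded_below) auto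
    then show False
      using weyl by (auto simp: weyl_solution_plus_def)
  qed
  have "0 \<le> E (x + 1)" by (rule nonneg)
  also have "\<dots> < E x" by (rule decreasing) simp
  finally have "(cmod (f x $ 2))\<^sup>2 < (cmod (f x $ 1))\<^sup>2"
    by (simp add: E_def)
  then show ?thesis
    by (rule power_less_imp_less_base) simp
qed

lemma weyl_quotient_riccati:
  assumes sol: "dirac_solution q z f" and nz: "f x $ 1 \<noteq> 0"
  shows "((\<lambda>x. f x $ 2 / f x $ 1) has_vector_derivative riccati q z (\<lambda>x. f x $ 2 / f x $ 1) x) (at x)"
proof -
  note d = dirac_solution_components[OF sol, of x]
  have "((inverse \<circ> (\<lambda>x. f x $ 1)) has_vector_derivative
      (- \<i> * z * f x $ 1 + \<i> * q x * f x $ 2) * - (inverse (f x $ 1) ^ Suc (Suc 0))) (at x)"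
    by (rule field_vector_diff_chain_at[OF d(1) DERIV_inverse[OF nz]])
  from has_vector_derivative_mult[OF d(2) this]
  have "((\<lambda>x. f x $ 2 / f x $ 1) has_vector_derivative
      f x $ 2 * ((- \<i> * z * f x $ 1 + \<i> * q x * f x $ 2) * - (inverse (f x $ 1) ^ Suc (Suc 0)))
      + (\<i> * z * f x $ 2 - \<i> * cnj (q x) * f x $ 1) * inverse (f x $ 1)) (at x)"
    by (simp add: divide_inverse o_def)
  moreover have "b * ((- \<i> * z * a + \<i> * Q * b) * - (inverse a ^ Suc (Suc 0)))
      + (\<i> * z * b - \<i> * cnj Q * a) * inverse a
      = 2 * \<i> * z * (b / a) - \<i> * (cnj Q + Q * (b / a)\<^sup>2)" if "a \<noteq> 0" for a b Q
    using that by (simp add: field_simps power2_eq_square)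
  ultimately show ?thesis
    using nz unfolding riccati_def by simp
qed

lemma weyl_plus_comparison:
  assumes weyl: "weyl_solution_plus q z f" and z: "Im z < 0" and q: "\<And>x. cmod (q x) \<le> B"
    and p: "\<And>x. (p has_vector_derivative riccati q z p x - \<rho> x) (at x)"
    and p_half: "\<And>x. cmod (p x) \<le> 1 / 2"
    and \<rho>: "\<And>x. cmod (\<rho> x) \<le> \<epsilon>" and \<epsilon>: "\<epsilon> \<le> - Im z / 2"
  shows "cmod (f 0 $ 2 / f 0 $ 1 - p 0) \<le> \<epsilon> / (- Im z)"
proof -
  have less: "cmod (f x $ 2) < cmod (f x $ 1)" for x
    by (rule weyl_solution_plus_disc[OF weyl z q])
  then have nz: "f x $ 1 \<noteq> 0" for x
    by (metis norm_not_less_zero norm_zero)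
  have disc: "cmod (f x $ 2 / f x $ 1) < 1" for x
    using less[of x] nz[of x] by (simp add: norm_divide)
  have "dirac_solution q z f"
    using weyl by (simp add: weyl_solution_plus_def)
  from weyl_quotient_riccati[OF this nz] show ?thesis
    by (rule riccati_comparison[OF _ disc p p_half \<rho> \<epsilon> z q])
qed

lemma vector_derivative_reflect:
  assumes "(f has_vector_derivative d) (at (- x))"
  shows "((\<lambda>x. f (- x)) has_vector_derivative - d) (at x)"
proof -
  have "(uminus has_vector_derivative - 1) (at (x::real))"
    by (auto intro!: derivative_eq_intros)
  from vector_diff_chain_at[OF this assms] show ?thesis by (simp add: o_def)
qed

text \<open>
The sign of the derivative changes under \<open>x \<mapsto> - x\<close>, and this is undone by changing the signs of \<open>q\<close> and
\<open>z\<close>; the components of the solution, hence also the quotient at the origin, stay the same.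
\<close>

lemma weyl_solution_reflect:
  assumes "weyl_solution_minus q z f"
  shows "weyl_solution_plus (\<lambda>x. - q (- x)) (- z) (\<lambda>x. f (- x))"
proof -
  have diff: "(f has_vector_derivative vector_derivative f (at x)) (at x)" for x
    using assms by (simp add: weyl_solution_minus_def dirac_solution_def vector_derivative_works)
  have eq: "dirac q f x = z *s f x" for x
    using assms by (simp add: weyl_solution_minus_def dirac_solution_def)
  have deriv: "((\<lambda>x. f (- x)) has_vector_derivative - vector_derivative f (at (- x))) (at x)" for x
    by (rule vector_derivative_reflect[OF diff])
  have "dirac (\<lambda>x. - q (- x)) (\<lambda>x. f (- x)) x = (- z) *s f (- x)" for x
    using eq[of "- x"] dirac_eq_iff[of "\<lambda>x. - q (- x)" "\<lambda>x. f (- x)" x "- z"] dirac_eq_iff[of q f "- x" z]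
    by (simp only: vector_derivative_at[OF deriv]) (simp add: algebra_simps)
  moreover have "(\<lambda>x. f (- x)) differentiable (at x)" for x
    using deriv differentiableI_vector by blast
  moreover obtain x1 where "f x1 \<noteq> 0"
    using assms by (auto simp: weyl_solution_minus_def)
  then have "f (- (- x1)) \<noteq> 0" by simp
  moreover obtain a where "set_integrable lborel {..a} (\<lambda>x. (norm (f x))\<^sup>2)"
    using assms by (auto simp: weyl_solution_minus_def)
  then have "set_integrable lborel {- a..} (\<lambda>x. (norm (f (- x)))\<^sup>2)"
    unfolding set_integrable_def
    by (subst lborel_integrable_real_affine_iff[of "- 1" _ 0, symmetric])
       (simp_all add: indicator_def minus_le_iff)
  ultimately show ?thesis
    unfolding weyl_solution_plus_def dirac_solution_def by blast
qed

lemma weyl_minus_comparison: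
  assumes weyl: "weyl_solution_minus q z f" and z: "Im z > 0" and q: "\<And>x. cmod (q x) \<le> B"
    and p: "\<And>x. (p has_vector_derivative riccati q z p x - \<rho> x) (at x)"
    and p_half: "\<And>x. cmod (p x) \<le> 1 / 2"
    and \<rho>: "\<And>x. cmod (\<rho> x) \<le> \<epsilon>" and \<epsilon>: "\<epsilon> \<le> Im z / 2"
  shows "cmod (f 0 $ 2 / f 0 $ 1 - p 0) \<le> \<epsilon> / Im z"
proof -
  have "((\<lambda>x. p (- x)) has_vector_derivative
      riccati (\<lambda>x. - q (- x)) (- z) (\<lambda>x. p (- x)) x - - \<rho> (- x)) (at x)" for x
    using vector_derivative_reflect[OF p[of "- x"]] by (simp add: riccati_def algebra_simps)
  then show ?thesis
    using weyl_plus_comparison[OF weyl_solution_reflect[OF weyl],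
        of B "\<lambda>x. p (- x)" "\<lambda>x. - \<rho> (- x)" \<epsilon>] z q p_half \<rho> \<epsilon> by simp
qed

text \<open>
The passage from the comparison estimate to the expansion, for both half planes at once. The lower bound
for \<open>\<bar>Im z\<bar>\<close> costs \<open>n\<close> of the \<open>K + 1\<close> orders of the residual; as \<open>n \<le> K\<close>, the residual is still
small compared with \<open>\<bar>Im z\<bar>\<close>, which the comparison requires.
\<close>

lemma expansion_from_comparison:
  assumes q: "bounded_lipschitz_deriv K q" and "n \<le> K" and "c > 0"
    and im: "\<And>z. z \<in> Z \<Longrightarrow> c * (1 + \<bar>Re z\<bar>) powi (- int n) \<le> \<bar>Im z\<bar>"
    and comparison: "\<And>z p \<rho> \<epsilon>. z \<in> Z \<Longrightarrow>
      (\<And>x. (p has_vector_derivative riccati q z p x - \<rho> x) (at x)) \<Longrightarrow>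
      (\<And>x. cmod (p x) \<le> 1 / 2) \<Longrightarrow> (\<And>x. cmod (\<rho> x) \<le> \<epsilon>) \<Longrightarrow> \<epsilon> \<le> \<bar>Im z\<bar> / 2 \<Longrightarrow>
      cmod (\<mu> z - p 0) \<le> \<epsilon> / \<bar>Im z\<bar>"
  shows "\<exists>C>0. \<exists>R>0. \<forall>z\<in>Z. cmod z \<ge> R \<longrightarrow>
    cmod (\<mu> z - (\<Sum>j = 1..K - n. dirac_coeff q j 0 * z powi (- int j)))
      \<le> C * cmod z powi (int n - int (Suc K))"
proof -
  obtain C where "C > 0" and C: "\<And>z. cmod z \<ge> 1 \<Longrightarrow> \<exists>p \<rho>.
      (\<forall>x. (p has_vector_derivative riccati q z p x - \<rho> x) (at x)) \<and>
      (\<forall>x. cmod (\<rho> x) \<le> C * cmod (inverse z) ^ Suc K) \<and>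
      (\<forall>x. cmod (p x) \<le> C * cmod (inverse z)) \<and>
      (\<forall>n\<le>K. cmod (p 0 - (\<Sum>j = 1..K - n. dirac_coeff q j 0 * inverse z ^ j))
          \<le> C * cmod (inverse z) ^ (Suc K - n))"
    using riccati_approximate_solution[OF q] by blast
  define c' where "c' = c / 2 ^ n"
  have "c' > 0" using \<open>c > 0\<close> by (simp add: c'_def)
  \<comment> \<open>The three summands ensure \<open>\<bar>z\<bar> \<ge> 1\<close>, \<open>\<bar>p\<bar> \<le> 1 / 2\<close> and \<open>\<bar>\<rho>\<bar> \<le> \<bar>Im z\<bar> / 2\<close>, respectively.\<close>
  define R where "R = 1 + 2 * C + 2 * C / c'"
  have "R > 0" using \<open>C > 0\<close> \<open>c' > 0\<close> by (simp add: R_def add_pos_pos)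
  have "cmod (\<mu> z - (\<Sum>j = 1..K - n. dirac_coeff q j 0 * z powi (- int j)))
      \<le> (C / c' + C) * cmod z powi (int n - int (Suc K))" if "z \<in> Z" "cmod z \<ge> R" for z
  proof -
    define h where "h = cmod (inverse z)"
    have z: "cmod z \<ge> 1" "cmod z \<ge> 2 * C" "cmod z \<ge> 2 * C / c'"
      using that(2) \<open>C > 0\<close> divide_pos_pos[of "2 * C" c'] \<open>c' > 0\<close> unfolding R_def by linarith+
    have "z \<noteq> 0" using z(1) by auto
    then have h: "h > 0" "h \<le> 1" "h * cmod z = 1"
      using z(1) by (auto simp: h_def norm_inverse inverse_le_1_iff)
    have "C * h \<le> 1 / 2"
    proof -
      have "2 * C * h \<le> cmod z * h" using z(2) h(1) by (intro mult_right_mono) auto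
      then show ?thesis using h(3) by (simp add: algebra_simps)
    qed
    have "C * h \<le> c' / 2"
    proof -
      have "2 * C / c' * h \<le> cmod z * h" using z(3) h(1) by (intro mult_right_mono) auto
      then have "2 * C / c' * h \<le> 1" using h(3) by (simp add: mult.commute)
      then show ?thesis using \<open>c' > 0\<close> by (simp add: field_simps)
    qed
    have powi: "cmod z powi (int n - int (Suc K)) = h ^ (Suc K - n)"
    proof -
      have "int n - int (Suc K) = - int (Suc K - n)" using \<open>n \<le> K\<close> by simp
      then show ?thesis
        by (simp only: power_int_minus power_int_of_nat) (simp add: h_def norm_inverse power_inverse)
    qed
    have eta: "c' * h ^ n \<le> \<bar>Im z\<bar>"
    proof -
      have "1 + \<bar>Re z\<bar> \<le> 2 * cmod z"
        using abs_Re_le_cmod[of z] z(1) by linarith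
      then have "(1 + \<bar>Re z\<bar>) ^ n \<le> (2 * cmod z) ^ n"
        by (intro power_mono) auto
      then have "inverse ((2 * cmod z) ^ n) \<le> inverse ((1 + \<bar>Re z\<bar>) ^ n)"
        by (intro le_imp_inverse_le) (auto intro!: zero_less_power)
      then have "c * inverse ((2 * cmod z) ^ n) \<le> c * inverse ((1 + \<bar>Re z\<bar>) ^ n)"
        using \<open>c > 0\<close> by (intro mult_left_mono) auto
      moreover have "c' * h ^ n = c * inverse ((2 * cmod z) ^ n)"
        by (simp add: c'_def h_def norm_inverse power_inverse power_mult_distrib divide_inverse)
      ultimately show ?thesis
        using im[OF that(1)] by (simp add: power_int_minus)
    qed
    have hpow: "h ^ Suc K = h ^ n * h ^ (Suc K - n)"
      using \<open>n \<le> K\<close> by (simp flip: power_add)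
    have im_pos: "\<bar>Im z\<bar> > 0"
      using eta \<open>c' > 0\<close> h(1) by (meson less_le_trans mult_pos_pos zero_less_power)
    obtain p \<rho> where p: "\<And>x. (p has_vector_derivative riccati q z p x - \<rho> x) (at x)"
      "\<And>x. cmod (\<rho> x) \<le> C * h ^ Suc K" "\<And>x. cmod (p x) \<le> C * h"
      "cmod (p 0 - (\<Sum>j = 1..K - n. dirac_coeff q j 0 * inverse z ^ j)) \<le> C * h ^ (Suc K - n)"
      using C[OF z(1)] \<open>n \<le> K\<close> unfolding h_def by blast
    have small: "C * h ^ Suc K \<le> \<bar>Im z\<bar> / 2"
    proof -
      have "h ^ (Suc K - n) \<le> h ^ 1"
        using h \<open>n \<le> K\<close> by (intro power_decreasing) auto
      then have "C * h ^ Suc K \<le> C * (h ^ n * h)"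
        unfolding hpow using \<open>C > 0\<close> h(1) by (intro mult_left_mono) auto
      also have "\<dots> = (C * h) * h ^ n" by simp
      also have "\<dots> \<le> (c' / 2) * h ^ n"
        using \<open>C * h \<le> c' / 2\<close> h(1) by (intro mult_right_mono) auto
      finally show ?thesis using eta by simp
    qed
    have "cmod (\<mu> z - p 0) \<le> C * h ^ Suc K / \<bar>Im z\<bar>"
      by (rule comparison[OF that(1) p(1) _ p(2) small]) (use p(3) \<open>C * h \<le> 1 / 2\<close> order_trans in blast)
    also have "\<dots> \<le> C * h ^ Suc K / (c' * h ^ n)"
      using eta \<open>C > 0\<close> \<open>c' > 0\<close> h(1) im_pos
      by (intro divide_left_mono mult_pos_pos zero_less_power) auto
    also have "\<dots> = C / c' * h ^ (Suc K - n)"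
      unfolding hpow using h(1) by simp
    finally have "cmod (\<mu> z - p 0) \<le> C / c' * h ^ (Suc K - n)" .
    then have "cmod ((\<mu> z - p 0) + (p 0 - (\<Sum>j = 1..K - n. dirac_coeff q j 0 * inverse z ^ j)))
        \<le> C / c' * h ^ (Suc K - n) + C * h ^ (Suc K - n)"
      using p(4) by (rule norm_triangle_mono)
    then show ?thesis
      unfolding powi by (simp add: power_int_minus power_inverse distrib_right)
  qed
  then show ?thesis
    using \<open>R > 0\<close> \<open>C > 0\<close> \<open>c' > 0\<close>
    by (intro exI[of _ "C / c' + C"] exI[of _ R] conjI ballI impI) (auto intro: add_pos_pos)
qed

theorem theorem3:
  fixes N n :: nat
    and q :: "real \<Rightarrow> complex"
    and \<gamma> :: "real \<Rightarrow> real"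
    and f_plus f_minus :: "complex \<Rightarrow> real \<Rightarrow> complex^2"
  assumes "N \<ge> 1" and "n \<le> N - 1"
    and "W_infty N q" and "continuous_on UNIV q"
    and "\<forall>t. \<gamma> t > 0" and "\<forall>t. \<gamma> (- t) = \<gamma> t"
    and "\<exists>c>0. \<exists>C>0. \<forall>t. c * (1 + \<bar>t\<bar>) powi (- int n) \<le> \<gamma> t \<and>
                          \<gamma> t \<le> C * (1 + \<bar>t\<bar>) powi (- int n)"
    and "\<forall>z. Im z < 0 \<longrightarrow> weyl_solution_plus q z (f_plus z)"
    and "\<forall>z. Im z > 0 \<longrightarrow> weyl_solution_minus q z (f_minus z)"
  shows "(\<exists>C>0. \<exists>R>0. \<forall>z\<in>Omega_minus \<gamma>. cmod z \<ge> R \<longrightarrow>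
            cmod (weyl_m f_plus z - (\<Sum>j = 1..N - n - 1. dirac_coeff q j 0 * z powi (- int j)))
              \<le> C * cmod z powi (int n - int N))
       \<and> (\<exists>C>0. \<exists>R>0. \<forall>z\<in>Omega_plus \<gamma>. cmod z \<ge> R \<longrightarrow>
            cmod (weyl_m f_minus z - (\<Sum>j = 1..N - n - 1. dirac_coeff q j 0 * z powi (- int j)))
              \<le> C * cmod z powi (int n - int N))"
proof -
  define K where "K = N - 1"
  have N: "N = Suc K" "N - n - 1 = K - n" "n \<le> K"
    using assms(1,2) by (auto simp: K_def)
  have q: "bounded_lipschitz_deriv K q"
    unfolding K_def by (rule W_infty_bounded_lipschitz_deriv[OF assms(1,3,4)])
  obtain B where B: "\<And>x. cmod (q x) \<le> B"
    using bounded_lipschitz_deriv_bounded[OF q] unfolding bounded_range_iff by blast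
  obtain c where c: "c > 0" "\<And>t. c * (1 + \<bar>t\<bar>) powi (- int n) \<le> \<gamma> t"
    using assms(7) by blast
  have lower: "Im z < 0" "c * (1 + \<bar>Re z\<bar>) powi (- int n) \<le> \<bar>Im z\<bar>" if "z \<in> Omega_minus \<gamma>" for z
    using that c(2)[of "Re z"] assms(5)[rule_format, of "Re z"] by (auto simp: Omega_minus_def)
  have upper: "Im z > 0" "c * (1 + \<bar>Re z\<bar>) powi (- int n) \<le> \<bar>Im z\<bar>" if "z \<in> Omega_plus \<gamma>" for z
    using that c(2)[of "Re z"] assms(5)[rule_format, of "Re z"] by (auto simp: Omega_plus_def)
  show ?thesis
    unfolding N(2) unfolding N(1)
  proof
    show "\<exists>C>0. \<exists>R>0. \<forall>z\<in>Omega_minus \<gamma>. cmod z \<ge> R \<longrightarrow>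
        cmod (weyl_m f_plus z - (\<Sum>j = 1..K - n. dirac_coeff q j 0 * z powi (- int j)))
          \<le> C * cmod z powi (int n - int (Suc K))"
    proof (rule expansion_from_comparison[OF q N(3) c(1) lower(2)])
      fix z p \<rho> \<epsilon>
      assume z: "z \<in> Omega_minus \<gamma>" and p: "\<And>x. (p has_vector_derivative riccati q z p x - \<rho> x) (at x)"
        "\<And>x. cmod (p x) \<le> 1 / 2" "\<And>x. cmod (\<rho> x) \<le> \<epsilon>" "\<epsilon> \<le> \<bar>Im z\<bar> / 2"
      have "weyl_solution_plus q z (f_plus z)"
        using assms(8) lower(1)[OF z] by blast
      from weyl_plus_comparison[OF this lower(1)[OF z] B p(1-3)] p(4) lower(1)[OF z]
      show "cmod (weyl_m f_plus z - p 0) \<le> \<epsilon> / \<bar>Im z\<bar>"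
        by (simp add: weyl_m_def)
    qed
    show "\<exists>C>0. \<exists>R>0. \<forall>z\<in>Omega_plus \<gamma>. cmod z \<ge> R \<longrightarrow>
        cmod (weyl_m f_minus z - (\<Sum>j = 1..K - n. dirac_coeff q j 0 * z powi (- int j)))
          \<le> C * cmod z powi (int n - int (Suc K))"
    proof (rule expansion_from_comparison[OF q N(3) c(1) upper(2)])
      fix z p \<rho> \<epsilon>
      assume z: "z \<in> Omega_plus \<gamma>" and p: "\<And>x. (p has_vector_derivative riccati q z p x - \<rho> x) (at x)"
        "\<And>x. cmod (p x) \<le> 1 / 2" "\<And>x. cmod (\<rho> x) \<le> \<epsilon>" "\<epsilon> \<le> \<bar>Im z\<bar> / 2"
      have "weyl_solution_minus q z (f_minus z)"
        using assms(9) upper(1)[OF z] by blast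
      from weyl_minus_comparison[OF this upper(1)[OF z] B p(1-3)] p(4) upper(1)[OF z]
      show "cmod (weyl_m f_minus z - p 0) \<le> \<epsilon> / \<bar>Im z\<bar>"
        by (simp add: weyl_m_def)
    qed
  qed
qed

end
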